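(* Let $k>1$ and let $A\subset\mathbb{T}^k$ be a Borel subset that has no translational symmetries. Let $v\in\mathbb{T}^k$ be such that the translation $T_v:\mathbb{T}^k\to\mathbb{T}^k$ is minimal, and let $F_w^n$ be the random iterations associated with $A$ and $v$. Then for Lebesgue-almost any $x,y\in\mathbb{T}^k$ and for $\mathbb{P}$-almost every $w\in\Omega$ one has the weak convergence of measures $$\frac1N\sum_{n=1}^N\delta_{F_w^n(x)-F_w^n(y)}\to\overline{\mu}\quad\text{as } N\to\infty,$$ where $\delta_p$ is the Dirac measure at $p$ and the probability measure $\overline{\mu}$ does not depend on $w$. Moreover, $\overline{\mu}$ is given explicitly by $$\overline{\mu}=\frac1Z\cdot\frac{dx}{\varphi_A(x)},\qquad Z=\int_{\mathbb{T}^k}\frac{dx}{\varphi_A(x)} .$$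
   Context: $\mathbb{T}^k=\mathbb{R}^k/\mathbb{Z}^k$ is the $k$-torus with normalized Lebesgue (Haar) probability measure $\mathrm{Leb}$; $T_u(x)=x+u$ is the translation by $u\in\mathbb{T}^k$. Standing assumption: $v\in\mathbb{T}^k$ is such that the components of $v$ together with $1$ form a $(k+1)$-tuple linearly independent over $\mathbb{Q}$ (equivalently, $T_v$ is minimal). For a Borel set $A\subset\mathbb{T}^k$, its displacement function is $\varphi_A:\mathbb{T}^k\to\mathbb{R}$, $\varphi_A(\varepsilon)=\mathrm{Leb}(A\,\triangle\,T_\varepsilon(A))$, where $\triangle$ is the symmetric difference. The set $A$ has no translational symmetries if $\varphi_A(\varepsilon)=0\Leftrightarrow\varepsilon=0$. Given $A$ and $v$, define $f:\mathbb{T}^k\to\mathbb{T}^k$ by $f(x)=x+v$ if $x\in A$ and $f(x)=x$ if $x\notin A$. For $u\in\mathbb{T}^k$ put $f_u=T_u\circ f$. Let $\Omega=(\mathbb{T}^k)^{\mathbb{N}}$ (sequences $w=(w_1,w_2,\dots)$) with the product probability measure $\mathbb{P}=\mathrm{Leb}^{\mathbb{N}}$. For $w\in\Omega$ set $F_w^n=f_{w_n}\circ\dots\circ f_{w_1}$. The assertion that $\overline{\mu}$ is a probability measure given by $\overline{\mu}=\frac1Z\cdot\frac{dx}{\varphi_A(x)}$ with $Z=\int_{\mathbb{T}^k}\frac{dx}{\varphi_A(x)}$ includes that $Z$ is finite. *)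

theory Defs
  imports "HOL-Probability.Probability"
begin

definition lattice_eq :: "real ^ 'k \<Rightarrow> real ^ 'k \<Rightarrow> bool" where
  "lattice_eq x y \<longleftrightarrow> (\<forall>i. x $ i - y $ i \<in> \<int>)"

lemma equivp_lattice_eq: "equivp lattice_eq"
proof (rule equivpI)
  show "reflp lattice_eq"
    by (auto simp: reflp_def lattice_eq_def)
  show "symp lattice_eq"
    unfolding symp_def lattice_eq_def by (metis Ints_minus minus_diff_eq)
  show "transp lattice_eq"
    unfolding transp_def lattice_eq_def
  proof (intro allI impI)
    fix x y z :: "real ^ 'k" and i
    assume "\<forall>i. x $ i - y $ i \<in> \<int>" "\<forall>i. y $ i - z $ i \<in> \<int>"
    then have "(x $ i - y $ i) + (y $ i - z $ i) \<in> \<int>"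
      by (intro Ints_add) auto
    then show "x $ i - z $ i \<in> \<int>"
      by simp
  qed
qed

quotient_type 'k torus = "real ^ 'k" / lattice_eq
  morphisms rep_torus to_torus
  by (rule equivp_lattice_eq)

instantiation torus :: (finite) ab_group_add
begin

lift_definition zero_torus :: "'a torus" is 0 .

lift_definition plus_torus :: "'a torus \<Rightarrow> 'a torus \<Rightarrow> 'a torus" is "(+)"
  unfolding lattice_eq_def by (metis Ints_add add_diff_add vector_add_component)

lift_definition minus_torus :: "'a torus \<Rightarrow> 'a torus \<Rightarrow> 'a torus" is "(-)"
proof -
  fix a b c d :: "real ^ 'a"
  assume "lattice_eq a b" "lattice_eq c d"
  then have "\<And>i. (a $ i - b $ i) - (c $ i - d $ i) \<in> \<int>"
    unfolding lattice_eq_def by (metis Ints_diff)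
  then show "lattice_eq (a - c) (b - d)"
    unfolding lattice_eq_def by (simp add: algebra_simps)
qed

lift_definition uminus_torus :: "'a torus \<Rightarrow> 'a torus" is "uminus"
  unfolding lattice_eq_def
  by (metis Ints_minus minus_diff_minus vector_uminus_component)

instance
proof (standard; transfer)
qed (auto simp: lattice_eq_def)

end

text \<open>The quotient topology.\<close>

instantiation torus :: (finite) topological_space
begin

definition open_torus :: "'a torus set \<Rightarrow> bool" where
  "open_torus U \<longleftrightarrow> open (to_torus -` U)"

instance
proof
  show "open (UNIV :: 'a torus set)"
    by (simp add: open_torus_def)
next
  fix S T :: "'a torus set"
  assume "open S" "open T"
  then show "open (S \<inter> T)"
    by (simp add: open_torus_def open_Int vimage_Int)
next
  fix K :: "'a torus set set"
  assume "\<forall>S\<in>K. open S"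
  then show "open (\<Union>K)"
    by (simp add: open_torus_def vimage_Union open_UN)
qed

end

lemma continuous_on_to_torus: "continuous_on UNIV (to_torus :: real ^ 'k::finite \<Rightarrow> 'k torus)"
  by (auto simp: continuous_on_open_vimage open_torus_def)

lemma measurable_to_torus [measurable]: "(to_torus :: real ^ 'k::finite \<Rightarrow> 'k torus) \<in> borel \<rightarrow>\<^sub>M borel"
  by (rule borel_measurable_continuous_onI[OF continuous_on_to_torus])

text \<open>Haar probability measure, as the image of Lebesgue measure on the half-open unit cube.\<close>

definition unit_cube :: "(real ^ 'k::finite) set" where
  "unit_cube = {x. \<forall>i. 0 \<le> x $ i \<and> x $ i < 1}"

definition Leb :: "'k::finite torus measure" where
  "Leb = distr (restrict_space lborel unit_cube) borel to_torus"

lemma sets_Leb [measurable_cong, simp]: "sets Leb = sets borel"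
  and space_Leb [simp]: "space Leb = UNIV"
  by (simp_all add: Leb_def)

lemma unit_cube_borel [measurable]: "unit_cube \<in> sets borel"
proof -
  have "unit_cube = (\<Inter>i. {x :: real ^ 'k. 0 \<le> x $ i} \<inter> {x. x $ i < 1})"
    by (auto simp: unit_cube_def)
  also have "\<dots> \<in> sets borel"
    by (intro sets.finite_INT sets.Int borel_closed borel_open closed_Collect_le
        open_Collect_less continuous_intros) auto
  finally show ?thesis .
qed

lemma emeasure_unit_cube: "emeasure lborel (unit_cube :: (real ^ 'k::finite) set) = 1"
proof -
  have b: "box 0 1 \<subseteq> (unit_cube :: (real ^ 'k) set)" "(unit_cube :: (real ^ 'k) set) \<subseteq> cbox 0 1"
    by (auto simp: unit_cube_def mem_box_cart less_imp_le)
  have one: "(\<Prod>b\<in>Basis. (1 - 0 :: real ^ 'k) \<bullet> b) = 1"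
    by (intro prod.neutral) (auto simp: Basis_vec_def inner_axis)
  have le: "\<And>b. b \<in> Basis \<Longrightarrow> (0 :: real ^ 'k) \<bullet> b \<le> 1 \<bullet> b"
    by (auto simp: Basis_vec_def inner_axis)
  have "emeasure lborel (box 0 (1 :: real ^ 'k)) = 1" "emeasure lborel (cbox 0 (1 :: real ^ 'k)) = 1"
    using emeasure_lborel_box[OF le] emeasure_lborel_cbox[OF le] one by simp_all
  with emeasure_mono[OF b(1), of lborel] emeasure_mono[OF b(2), of lborel] show ?thesis
    by (simp add: antisym)
qed

lemma prob_space_Leb: "prob_space (Leb :: 'k::finite torus measure)"
  unfolding Leb_def
proof (rule prob_space.prob_space_distr)
  show "prob_space (restrict_space lborel (unit_cube :: (real ^ 'k) set))"
    by (intro prob_spaceI)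
      (simp add: space_restrict_space emeasure_restrict_space emeasure_unit_cube)
  show "to_torus \<in> restrict_space lborel (unit_cube :: (real ^ 'k) set) \<rightarrow>\<^sub>M borel"
    by (intro measurable_restrict_space1) simp
qed

definition translation :: "'k::finite torus \<Rightarrow> 'k torus \<Rightarrow> 'k torus" where
  "translation u x = x + u"

definition minimal_map :: "('a::topological_space \<Rightarrow> 'a) \<Rightarrow> bool" where
  "minimal_map T \<longleftrightarrow> (\<forall>x. closure (range (\<lambda>n. (T ^^ n) x)) = UNIV)"

definition displacement :: "'k::finite torus set \<Rightarrow> 'k torus \<Rightarrow> real" where
  "displacement A \<epsilon> = measure Leb ((A - translation \<epsilon> ` A) \<union> (translation \<epsilon> ` A - A))"

definition no_translational_symmetries :: "'k::finite torus set \<Rightarrow> bool" where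
  "no_translational_symmetries A \<longleftrightarrow> (\<forall>\<epsilon>. displacement A \<epsilon> = 0 \<longleftrightarrow> \<epsilon> = 0)"

definition base_map :: "'k::finite torus set \<Rightarrow> 'k torus \<Rightarrow> 'k torus \<Rightarrow> 'k torus" where
  "base_map A v x = (if x \<in> A then x + v else x)"

definition noisy_map :: "'k::finite torus set \<Rightarrow> 'k torus \<Rightarrow> 'k torus \<Rightarrow> 'k torus \<Rightarrow> 'k torus" where
  "noisy_map A v u = translation u \<circ> base_map A v"

text \<open>Noise sequences are indexed from 0, so \<open>w n\<close> is the noise applied at time \<open>n + 1\<close>.\<close>

definition noise_measure :: "(nat \<Rightarrow> 'k::finite torus) measure" where
  "noise_measure = PiM UNIV (\<lambda>_. Leb)"

primrec random_iterate ::
    "'k::finite torus set \<Rightarrow> 'k torus \<Rightarrow> (nat \<Rightarrow> 'k torus) \<Rightarrow> nat \<Rightarrow> 'k torus \<Rightarrow> 'k torus" where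
  "random_iterate A v w 0 = id"
| "random_iterate A v w (Suc n) = noisy_map A v (w n) \<circ> random_iterate A v w n"

text \<open>The average of the Dirac measures at \<open>p 1, \<dots>, p N\<close> (the zero measure if \<open>N = 0\<close>).\<close>

definition empirical_measure :: "(nat \<Rightarrow> 'a::topological_space) \<Rightarrow> nat \<Rightarrow> 'a measure" where
  "empirical_measure p N =
     measure_of UNIV (sets borel)
       (\<lambda>B. ennreal (1 / real N) * (\<Sum>n=1..N. emeasure (return borel (p n)) B))"

lemma sets_empirical_measure [measurable_cong, simp]: "sets (empirical_measure p N) = sets borel"
  and space_empirical_measure [simp]: "space (empirical_measure p N) = UNIV"
  using sets.sigma_sets_eq[of borel] sets.space_closed[of borel]
  by (simp_all add: empirical_measure_def sets_measure_of)

lemma emeasure_empirical_measure: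
  assumes "B \<in> sets borel"
  shows "emeasure (empirical_measure p N) B =
    ennreal (1 / real N) * (\<Sum>n=1..N. indicator B (p n))"
proof -
  have "emeasure (empirical_measure p N) B =
      ennreal (1 / real N) * (\<Sum>n=1..N. emeasure (return borel (p n)) B)"
  proof (rule emeasure_measure_of[OF empirical_measure_def])
    show "countably_additive (sets (empirical_measure p N))
        (\<lambda>B. ennreal (1 / real N) * (\<Sum>n=1..N. emeasure (return borel (p n)) B))"
    proof (rule countably_additiveI)
      fix D :: "nat \<Rightarrow> 'a set"
      assume "range D \<subseteq> sets (empirical_measure p N)" "disjoint_family D"
      then have D: "(\<Sum>i. emeasure (return borel x) (D i)) = emeasure (return borel x) (\<Union>i. D i)" for x
        by (intro suminf_emeasure) auto
      show "(\<Sum>i. ennreal (1 / real N) * (\<Sum>n=1..N. emeasure (return borel (p n)) (D i))) =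
          ennreal (1 / real N) * (\<Sum>n=1..N. emeasure (return borel (p n)) (\<Union>i. D i))"
        by (subst ennreal_suminf_cmult, subst suminf_sum) (simp_all add: D)
    qed
  qed (use assms in \<open>auto simp: positive_def\<close>)
  with assms show ?thesis
    by simp
qed

definition weakly_converges :: "(nat \<Rightarrow> 'a::topological_space measure) \<Rightarrow> 'a measure \<Rightarrow> bool" where
  "weakly_converges M L \<longleftrightarrow>
     (\<forall>g :: 'a \<Rightarrow> real. continuous_on UNIV g \<longrightarrow> bounded (range g) \<longrightarrow>
        (\<lambda>N. integral\<^sup>L (M N) g) \<longlonglongrightarrow> integral\<^sup>L L g)"

text \<open>The reciprocal is taken in the extended nonnegative reals, where \<open>1 / 0 = \<infinity>\<close>.\<close>

definition inv_displacement :: "'k::finite torus set \<Rightarrow> 'k torus \<Rightarrow> ennreal" where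
  "inv_displacement A x = 1 / ennreal (displacement A x)"

definition norm_const :: "'k::finite torus set \<Rightarrow> ennreal" where
  "norm_const A = (\<integral>\<^sup>+ x. inv_displacement A x \<partial>Leb)"

definition mu_bar :: "'k::finite torus set \<Rightarrow> 'k torus measure" where
  "mu_bar A = scale_measure (1 / norm_const A) (density Leb (inv_displacement A))"

end

theory Submission
  imports Defs
begin

text \<open>
  If \<open>x\<close> is the first of two points whose difference is \<open>z\<close>, one step of the dynamics adds
  \<open>v\<close>, \<open>-v\<close> or \<open>0\<close> to \<open>z\<close>, depending only on \<open>x\<close> and \<open>z\<close>. The noise makes the successive
  positions of the first point independent and uniform, so the differences perform a symmetric
  random walk along the orbit of \<open>T\<^sub>v\<close> which leaves \<open>z\<close> with probability \<open>\<phi>\<^sub>A z\<close>; it is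
  reversible with respect to \<open>dx / \<phi>\<^sub>A x\<close>. By subadditivity \<open>\<phi>\<^sub>A\<close> grows at least linearly near
  \<open>0\<close>, so this measure is finite in dimension at least \<open>2\<close>.

  The convergence of time averages is Birkhoff's theorem for the skew product of the walk with the
  shift. It is deduced from Garsia's maximal inequality, applied to a function \<open>f z\<close> with negative
  mean: the probability of unbounded sums, given the starting point, is a bounded harmonic
  function, hence constant on each orbit of \<open>T\<^sub>v\<close>, hence almost everywhere equal to some \<open>c\<close> by
  minimality; the inequality reads \<open>0 \<le> c \<integral>f\<close>, which forces \<open>c = 0\<close>.
\<close>

text \<open>Three points shape the details. First, the state 0 is absorbing for the difference and
  is where the density is infinite; arguments along an orbit of the translation therefore hold only
  for starting points whose orbit misses 0, which is almost every one. Second, \<open>x\<close>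
  itself is a fixed point and not a random one, so its first move is deterministic: the random walk
  starts with the difference at time 1, and its driving sequence consists of the positions of the
  first point from time 1 on. For almost all \<open>x\<close> and \<open>y\<close> this starting
  state avoids a given null set, since it is one of three translates of \<open>x - y\<close>. Third,
  the exceptional null set may depend on the test function, so weak convergence is reduced to
  countably many indicators of grid cells.

  Displacement functions serve twice: that of \<open>A\<close> gives the jump rate, and those of the
  level sets of an invariant function turn minimality into ergodicity of the translation.\<close>

lemma to_torus_eq_iff: "to_torus x = to_torus y \<longleftrightarrow> (\<forall>i. x $ i - y $ i \<in> \<int>)"
  by (simp add: torus.abs_eq_iff lattice_eq_def)

lemma to_torus_add: "to_torus (x + y) = to_torus x + to_torus y"
  and to_torus_diff: "to_torus (x - y) = to_torus x - to_torus y"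
  and to_torus_zero: "to_torus 0 = 0"
  by (simp_all add: plus_torus.abs_eq minus_torus.abs_eq zero_torus.abs_eq)

lemma to_torus_rep_torus [simp]: "to_torus (rep_torus x) = x"
  using Quotient3_abs_rep[OF Quotient3_torus] .

section \<open>Fibres of the quotient map and the Borel structure of the torus\<close>

definition int_vecs :: "(real ^ 'k::finite) set" where
  "int_vecs = {n. \<forall>i. n $ i \<in> \<int>}"

lemma countable_int_vecs: "countable (int_vecs :: (real ^ 'k::finite) set)"
proof -
  have "countable (PiE (UNIV :: 'k set) (\<lambda>_. \<int> :: real set))"
    by (intro countable_PiE) (simp_all add: Ints_def)
  moreover have "int_vecs = vec_lambda ` (PiE (UNIV :: 'k set) (\<lambda>_. \<int> :: real set))"
  proof (intro equalityI subsetI)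
    fix n :: "real ^ 'k" assume "n \<in> int_vecs"
    then show "n \<in> vec_lambda ` (PiE UNIV (\<lambda>_. \<int>))"
      by (intro image_eqI[of _ _ "vec_nth n"]) (auto simp: int_vecs_def)
  qed (auto simp: int_vecs_def PiE_iff)
  ultimately show ?thesis by (metis countable_image)
qed

lemma to_torus_add_int_vecs [simp]: "n \<in> int_vecs \<Longrightarrow> to_torus (x + n) = to_torus x"
  by (simp add: to_torus_eq_iff int_vecs_def)

text \<open>The preimage of the image of \<open>U\<close> is the union of the integer translates of
  \<open>U\<close>, each of them open.\<close>

lemma open_image_to_torus:
  fixes U :: "(real ^ 'k::finite) set"
  assumes "open U"
  shows "open (to_torus ` U)"
proof -
  have "to_torus -` to_torus ` U = (\<Union>n\<in>int_vecs. (+) n ` U)"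
  proof (intro equalityI subsetI)
    fix x assume "x \<in> to_torus -` to_torus ` U"
    then obtain y where "y \<in> U" "to_torus x = to_torus y" by auto
    then show "x \<in> (\<Union>n\<in>int_vecs. (+) n ` U)"
      by (intro UN_I[of "x - y"]) (auto simp: to_torus_eq_iff int_vecs_def image_iff)
  next
    fix x assume "x \<in> (\<Union>n\<in>int_vecs. (+) n ` U)"
    then obtain n y where "n \<in> int_vecs" "y \<in> U" "x = n + y" by auto
    then show "x \<in> to_torus -` to_torus ` U"
      by (auto simp: add.commute[of n])
  qed
  then show ?thesis
    unfolding open_torus_def using assms by (auto intro!: open_UN open_translation)
qed

text \<open>The representative \<open>rep_torus\<close> is an arbitrary choice; reducing it modulo 1
  gives the section with values in the half-open cube, which is Borel.\<close>

definition frac_rep :: "'k::finite torus \<Rightarrow> real ^ 'k" where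
  "frac_rep x = (\<chi> i. frac (rep_torus x $ i))"

lemma to_torus_frac_rep [simp]: "to_torus (frac_rep x) = x"
proof -
  have "to_torus (frac_rep x) = to_torus (rep_torus x)"
    by (simp only: to_torus_eq_iff frac_rep_def frac_def) simp
  then show ?thesis by simp
qed

lemma frac_rep_unit_cube: "frac_rep x \<in> unit_cube"
  by (simp add: frac_rep_def unit_cube_def frac_lt_1)

lemma frac_rep_to_torus: "frac_rep (to_torus y) $ i = frac (y $ i)"
proof -
  have "rep_torus (to_torus y) $ i - y $ i \<in> \<int>"
    using to_torus_eq_iff[of "rep_torus (to_torus y)" y] by simp
  then obtain m where "rep_torus (to_torus y) $ i = y $ i + of_int m"
    by (metis Ints_cases add_diff_cancel_left' diff_add_cancel add.commute)
  then show ?thesis by (simp add: frac_rep_def)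
qed

lemma measurable_frac_rep_nth: "(\<lambda>x. frac_rep x $ i) \<in> borel_measurable borel"
proof (rule borel_measurableI_less)
  fix a :: real
  consider "a \<le> 0" | "0 < a" "a \<le> 1" | "1 < a" by linarith
  then show "{x \<in> space borel. frac_rep x $ i < a} \<in> sets borel"
  proof cases
    case 1
    then have "\<not> frac_rep x $ i < a" for x :: "'a torus"
      using frac_ge_0[of "rep_torus x $ i"] by (simp add: frac_rep_def not_less del: frac_ge_0)
    then show ?thesis by simp
  next
    case 3
    then have "frac_rep x $ i < a" for x :: "'a torus"
      using frac_lt_1[of "rep_torus x $ i"] by (simp add: frac_rep_def)
    then show ?thesis by simp
  next
    case 2
    \<comment> \<open>The coordinate jumps at integers. Values in (0, a) form the image of an open
      strip, and the value 0 is attained exactly off the image of the open set of vectors whose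
      coordinate is not an integer.\<close>
    have "{x \<in> space borel. frac_rep x $ i < a} =
        to_torus ` ({y. 0 < y $ i} \<inter> {y. y $ i < a}) \<union> - to_torus ` {y. y $ i \<notin> \<int>}"
      (is "_ = ?R")
    proof (intro set_eqI iffI)
      fix x assume x: "x \<in> {x \<in> space borel. frac_rep x $ i < a}"
      show "x \<in> ?R"
      proof (cases "frac_rep x $ i = 0")
        case True
        have "x \<notin> to_torus ` {y. y $ i \<notin> \<int>}"
          using True by (auto simp: frac_rep_to_torus)
        then show ?thesis by simp
      next
        case False
        then have "0 < frac_rep x $ i"
          using frac_ge_0[of "rep_torus x $ i"] by (simp add: frac_rep_def del: frac_ge_0)
        with x show ?thesis
          by (intro UnI1 image_eqI[of _ _ "frac_rep x"]) auto
      qed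
    next
      fix x assume x: "x \<in> ?R"
      then show "x \<in> {x \<in> space borel. frac_rep x $ i < a}"
      proof
        assume "x \<in> to_torus ` ({y. 0 < y $ i} \<inter> {y. y $ i < a})"
        then obtain y where "0 < y $ i" "y $ i < a" "x = to_torus y" by auto
        then show ?thesis using 2
          by (simp add: frac_rep_to_torus frac_eq[THEN iffD2])
      next
        assume *: "x \<in> - to_torus ` {y. y $ i \<notin> \<int>}"
        have "frac_rep x $ i \<in> \<int>"
        proof (rule ccontr)
          assume "frac_rep x $ i \<notin> \<int>"
          with * show False by (auto simp: image_iff dest!: spec[of _ "frac_rep x"])
        qed
        then have "frac (frac_rep x $ i) = 0" by simp
        moreover have "frac (frac_rep x $ i) = frac_rep x $ i"
          using frac_rep_unit_cube[of x] by (simp add: frac_eq unit_cube_def)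
        ultimately have "frac_rep x $ i = 0" by simp
        then show ?thesis using 2 by simp
      qed
    qed
    moreover have "open (to_torus ` ({y. 0 < y $ i} \<inter> {y::real^'a. y $ i < a}))"
      by (intro open_image_to_torus open_Int open_Collect_less continuous_intros)
    moreover have "open (to_torus ` {y::real^'a. y $ i \<notin> \<int>})"
    proof (intro open_image_to_torus)
      have "{y::real^'a. y $ i \<notin> \<int>} = (\<lambda>y. y $ i) -` (- \<int>)" by auto
      also have "open \<dots>"
        by (intro open_vimage continuous_intros) (simp add: open_Compl)
      finally show "open {y::real^'a. y $ i \<notin> \<int>}" .
    qed
    ultimately show ?thesis by auto
  qed
qed

lemma measurable_frac_rep [measurable]: "frac_rep \<in> borel_measurable borel"
proof (subst borel_measurable_euclidean_space, intro ballI)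
  fix b :: "real ^ 'a" assume "b \<in> Basis"
  then obtain i where "b = axis i 1" by (auto simp: Basis_vec_def)
  then show "(\<lambda>x. frac_rep x \<bullet> b) \<in> borel_measurable borel"
    by (simp add: inner_axis measurable_frac_rep_nth)
qed

text \<open>Add the representatives in the cube and project: this reduces the claim to Borel
  functions with values in a Euclidean space.\<close>

lemma measurable_torus_add [measurable]:
  fixes f g :: "'a \<Rightarrow> 'k::finite torus"
  assumes [measurable]: "f \<in> borel_measurable M" "g \<in> borel_measurable M"
  shows "(\<lambda>x. f x + g x) \<in> borel_measurable M"
proof -
  have "(\<lambda>x. to_torus (frac_rep (f x) + frac_rep (g x))) \<in> borel_measurable M"
    by measurable
  then show ?thesis by (simp add: to_torus_add)
qed

lemma measurable_torus_diff [measurable]: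
  fixes f g :: "'a \<Rightarrow> 'k::finite torus"
  assumes [measurable]: "f \<in> borel_measurable M" "g \<in> borel_measurable M"
  shows "(\<lambda>x. f x - g x) \<in> borel_measurable M"
proof -
  have "(\<lambda>x. to_torus (frac_rep (f x) - frac_rep (g x))) \<in> borel_measurable M"
    by measurable
  then show ?thesis by (simp add: to_torus_diff)
qed

text \<open>The Borel section \<open>frac_rep\<close> is injective, so a point is the preimage of a
  point.\<close>

lemma sets_borel_singleton_torus [measurable]: "{x :: 'k::finite torus} \<in> sets borel"
proof -
  have "y = x" if "frac_rep y = frac_rep x" for y
    using arg_cong[OF that, of to_torus] by simp
  then have "{x} = frac_rep -` {frac_rep x} \<inter> space borel" by auto
  also have "\<dots> \<in> sets borel" by measurable
  finally show ?thesis .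
qed

subsection \<open>Fundamental domains\<close>

text \<open>The integer translates of a half-open cube tile space. The sum over the lattice is
  written as an integral over \<open>count_space\<close>, so that it can be reindexed by a
  bijection.\<close>

lemma emeasure_lborel_cube_partition:
  fixes X :: "(real ^ 'k::finite) set"
  assumes "X \<in> sets borel"
  shows "emeasure lborel X = (\<integral>\<^sup>+n. emeasure lborel (X \<inter> {x. x - (a + n) \<in> unit_cube}) \<partial>count_space int_vecs)"
proof -
  have "(\<Union>n\<in>int_vecs. X \<inter> {x. x - (a + n) \<in> unit_cube}) = X"
  proof -
    have "\<exists>n\<in>int_vecs. x - (a + n) \<in> unit_cube" for x :: "real ^ 'k"
      by (rule bexI[of _ "\<chi> i. of_int \<lfloor>x $ i - a $ i\<rfloor>"])
        (auto simp: unit_cube_def int_vecs_def, linarith+)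
    then show ?thesis by blast
  qed
  moreover have "disjoint_family_on (\<lambda>n. X \<inter> {x. x - (a + n) \<in> unit_cube}) int_vecs"
  unfolding disjoint_family_on_def
  proof (intro ballI impI)
    fix m n :: "real ^ 'k" assume mn: "m \<in> int_vecs" "n \<in> int_vecs" "m \<noteq> n"
    { fix x assume x: "x - (a + m) \<in> unit_cube" "x - (a + n) \<in> unit_cube"
      have "m $ i = n $ i" for i
      proof -
        have "m $ i \<in> \<int>" "n $ i \<in> \<int>"
          using mn by (auto simp: int_vecs_def)
        then obtain p q :: int where "m $ i = of_int p" "n $ i = of_int q"
          by (auto elim!: Ints_cases)
        with x show ?thesis unfolding unit_cube_def
          by (auto dest!: spec[of _ i]) 
      qed
      then have False using mn by (simp add: vec_eq_iff) }
    then show "X \<inter> {x. x - (a + m) \<in> unit_cube} \<inter> (X \<inter> {x. x - (a + n) \<in> unit_cube}) = {}"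
      by auto
  qed
  moreover have "X \<inter> {x. x - (a + n) \<in> unit_cube} \<in> sets lborel" for n
    using assms by simp
  ultimately show ?thesis
    using emeasure_UN_countable[of int_vecs "\<lambda>n. X \<inter> {x. x - (a + n) \<in> unit_cube}" lborel]
      countable_int_vecs by auto
qed

lemma emeasure_lborel_translate:
  fixes X :: "(real ^ 'k::finite) set"
  assumes "X \<in> sets borel"
  shows "emeasure lborel {x. c + x \<in> X} = emeasure lborel X"
proof -
  have "emeasure lborel X = emeasure (distr lborel borel ((+) c)) X"
    by (simp only: lborel_distr_plus)
  also have "\<dots> = emeasure lborel {x. c + x \<in> X}"
    using assms by (subst emeasure_distr) (auto simp: vimage_def)
  finally show ?thesis ..
qed

text \<open>Every translate of the unit cube is a fundamental domain. Cut the translate by the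
  lattice of unit cubes and move each piece back by its integer vector: the result is the unit cube
  cut by the lattice of translates. The freedom in \<open>a\<close> yields translation invariance
  and, later, the centred cube.\<close>

lemma emeasure_Leb_cube:
  fixes B :: "'k::finite torus set"
  assumes [measurable]: "B \<in> sets borel"
  shows "emeasure Leb B = emeasure lborel {x. x - a \<in> unit_cube \<and> to_torus x \<in> B}"
proof -
  have m: "(\<lambda>x. x - a) \<in> borel_measurable borel" for a :: "real ^ 'k" by simp
  have [measurable]: "{x. x - a \<in> unit_cube \<and> to_torus x \<in> B} \<in> sets borel" for a
    by measurable
  have "emeasure lborel {x. x - a \<in> unit_cube \<and> to_torus x \<in> B}
      = (\<integral>\<^sup>+n. emeasure lborel ({x. x - a \<in> unit_cube \<and> to_torus x \<in> B} \<inter> {x. x - (0 + n) \<in> unit_cube}) \<partial>count_space int_vecs)"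
    by (rule emeasure_lborel_cube_partition) simp
  also have "\<dots> = (\<integral>\<^sup>+n. emeasure lborel ({x. x \<in> unit_cube \<and> to_torus x \<in> B} \<inter> {x. x - (a + (- n)) \<in> unit_cube}) \<partial>count_space int_vecs)"
  proof (intro nn_integral_cong)
    fix n :: "real ^ 'k" assume "n \<in> space (count_space int_vecs)"
    then have n: "n \<in> int_vecs" by simp
    have "emeasure lborel ({x. x - a \<in> unit_cube \<and> to_torus x \<in> B} \<inter> {x. x - (0 + n) \<in> unit_cube})
      = emeasure lborel {x. n + x \<in> {x. x - a \<in> unit_cube \<and> to_torus x \<in> B} \<inter> {x. x - (0 + n) \<in> unit_cube}}"
      by (subst emeasure_lborel_translate) measurable
    \<comment> \<open>The shift by an integer vector does not change the projection; it exchanges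
      the roles of the two cubes and the sign of \<open>n\<close>.\<close>
    also have "{x. n + x \<in> {x. x - a \<in> unit_cube \<and> to_torus x \<in> B} \<inter> {x. x - (0 + n) \<in> unit_cube}}
      = {x. x \<in> unit_cube \<and> to_torus x \<in> B} \<inter> {x. x - (a + (- n)) \<in> unit_cube}"
      using n by (auto simp: add.commute[of n] algebra_simps)
    finally show "emeasure lborel ({x. x - a \<in> unit_cube \<and> to_torus x \<in> B} \<inter> {x. x - (0 + n) \<in> unit_cube})
      = emeasure lborel ({x. x \<in> unit_cube \<and> to_torus x \<in> B} \<inter> {x. x - (a + (- n)) \<in> unit_cube})" .
  qed
  also have "\<dots> = (\<integral>\<^sup>+n. emeasure lborel ({x. x \<in> unit_cube \<and> to_torus x \<in> B} \<inter> {x. x - (a + n) \<in> unit_cube}) \<partial>count_space int_vecs)"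
    by (rule nn_integral_bij_count_space[where g=uminus])
      (auto intro!: bij_betwI[where g=uminus] simp: int_vecs_def)
  also have "\<dots> = emeasure lborel {x. x \<in> unit_cube \<and> to_torus x \<in> B}"
    by (rule emeasure_lborel_cube_partition[symmetric]) measurable
  also have "\<dots> = emeasure Leb B"
    unfolding Leb_def
    by (subst emeasure_distr)
       (auto simp: emeasure_restrict_space space_restrict_space intro!: measurable_restrict_space1 arg_cong[where f="emeasure lborel"])
  finally show ?thesis ..
qed

lemma distr_Leb_add: "distr Leb borel (\<lambda>x. x + u) = (Leb :: 'k::finite torus measure)"
proof (rule measure_eqI)
  fix B :: "'k torus set" assume "B \<in> sets (distr Leb borel (\<lambda>x. x + u))"
  then have [measurable]: "B \<in> sets borel" by simp
  define c where "c = rep_torus u"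
  have u: "u = to_torus c" by (simp add: c_def)
  have [measurable]: "(\<lambda>x. x + u) \<in> borel_measurable borel" by measurable
  have "emeasure (distr Leb borel (\<lambda>x. x + u)) B = emeasure Leb {x. x + u \<in> B}"
    by (subst emeasure_distr) (auto simp: vimage_def)
  also have "\<dots> = emeasure lborel {x. x - 0 \<in> unit_cube \<and> to_torus x \<in> {x. x + u \<in> B}}"
    by (rule emeasure_Leb_cube) measurable
  also have "\<dots> = emeasure lborel {x. c + x \<in> {x. x - c \<in> unit_cube \<and> to_torus x \<in> B}}"
    by (simp add: u to_torus_add add.commute)
  also have "\<dots> = emeasure lborel {x. x - c \<in> unit_cube \<and> to_torus x \<in> B}"
    by (rule emeasure_lborel_translate) measurable
  also have "\<dots> = emeasure Leb B"
    by (rule emeasure_Leb_cube[symmetric]) simp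
  finally show "emeasure (distr Leb borel (\<lambda>x. x + u)) B = emeasure Leb B" .
qed simp

subsection \<open>The displacement function\<close>

lemma sets_borel_sigma_sets: "sets borel = sigma_sets UNIV {S. open S}"
  by (simp add: borel_def)

interpretation Leb: prob_space "Leb :: 'k::finite torus measure"
  by (rule prob_space_Leb)

lemma measurable_Leb_add [measurable]: "(\<lambda>x. x + u) \<in> borel_measurable (Leb :: 'k::finite torus measure)"
  by measurable

lemma AE_Leb_add:
  assumes "AE x in (Leb :: 'k::finite torus measure). P x"
  shows "AE x in Leb. P (x + u)"
proof -
  have "(\<lambda>x. x + u) \<in> measurable Leb (borel :: 'k torus measure)" by measurable
  moreover have "AE x in distr Leb borel (\<lambda>x. x + u). P x"
    using assms by (subst distr_Leb_add)
  ultimately show ?thesis by (rule AE_distrD)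
qed

lemma nn_integral_Leb_add:
  fixes f :: "'k::finite torus \<Rightarrow> ennreal"
  assumes [measurable]: "f \<in> borel_measurable borel"
  shows "(\<integral>\<^sup>+x. f (x + u) \<partial>Leb) = (\<integral>\<^sup>+x. f x \<partial>Leb)"
proof -
  have "(\<integral>\<^sup>+x. f x \<partial>Leb) = (\<integral>\<^sup>+x. f x \<partial>distr Leb borel (\<lambda>x. x + u))"
    by (simp add: distr_Leb_add)
  also have "\<dots> = (\<integral>\<^sup>+x. f (x + u) \<partial>Leb)"
    by (rule nn_integral_distr) measurable
  finally show ?thesis ..
qed

lemma measure_Leb_add:
  fixes B :: "'k::finite torus set"
  assumes [measurable]: "B \<in> sets borel"
  shows "measure Leb {x. x + u \<in> B} = measure Leb B"
proof -
  have "measure Leb B = measure (distr Leb borel (\<lambda>x. x + u)) B"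
    by (simp add: distr_Leb_add)
  also have "\<dots> = measure Leb {x. x + u \<in> B}"
    by (subst measure_distr) (auto simp: vimage_def)
  finally show ?thesis ..
qed

lemma measure_Leb_diff:
  fixes B :: "'k::finite torus set"
  assumes "B \<in> sets borel"
  shows "measure Leb {x. x - u \<in> B} = measure Leb B"
  using measure_Leb_add[OF assms, of "- u"] by simp

lemma displacement_eq: "displacement A e = measure Leb {x. (x \<in> A) \<noteq> (x - e \<in> A)}"
proof -
  have "translation e ` A = {x. x - e \<in> A}"
    by (auto simp: translation_def image_iff) (metis diff_add_cancel)
  then show ?thesis
    unfolding displacement_def by (intro arg_cong[of _ _ "measure Leb"]) auto
qed

lemma displacement_nonneg: "0 \<le> displacement A e"
  by (simp add: displacement_def)

lemma displacement_le_1: "displacement A e \<le> 1"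
  by (simp add: displacement_def)

lemma displacement_0 [simp]: "displacement A 0 = 0"
  by (simp add: displacement_eq)

context
  fixes A :: "'k::finite torus set"
  assumes A [measurable]: "A \<in> sets borel"
begin

lemma displacement_minus: "displacement A (- e) = displacement A e"
proof -
  have "displacement A (- e) = measure Leb {x. x + e \<in> {y. (y \<in> A) \<noteq> (y - e \<in> A)}}"
    unfolding displacement_eq by (intro arg_cong[of _ _ "measure Leb"]) auto
  also have "\<dots> = displacement A e"
    unfolding displacement_eq by (rule measure_Leb_add) measurable
  finally show ?thesis .
qed

lemma displacement_add: "displacement A (a + b) \<le> displacement A a + displacement A b"
proof -
  have "displacement A (a + b) \<le> measure Leb ({x. (x \<in> A) \<noteq> (x - a \<in> A)} \<union> {x. (x - a \<in> A) \<noteq> (x - a - b \<in> A)})"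
    unfolding displacement_eq by (intro Leb.finite_measure_mono) (auto simp: diff_diff_eq)
  also have "\<dots> \<le> measure Leb {x. (x \<in> A) \<noteq> (x - a \<in> A)} + measure Leb {x. (x - a \<in> A) \<noteq> (x - a - b \<in> A)}"
    by (intro measure_Un_le) measurable
  also have "measure Leb {x. (x - a \<in> A) \<noteq> (x - a - b \<in> A)} = measure Leb {x. x - a \<in> {x. (x \<in> A) \<noteq> (x - b \<in> A)}}"
    by simp
  also have "\<dots> = measure Leb {x. (x \<in> A) \<noteq> (x - b \<in> A)}"
    by (rule measure_Leb_diff) measurable
  finally show ?thesis by (simp add: displacement_eq)
qed

text \<open>This is the reverse triangle inequality of the translation-invariant pseudometric given
  by \<open>displacement A\<close>; it reduces continuity everywhere to continuity at 0.\<close>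

lemma displacement_diff_le: "\<bar>displacement A a - displacement A b\<bar> \<le> displacement A (a - b)"
  using displacement_add[of "a - b" b] displacement_add[of "b - a" a] displacement_minus[of "a - b"]
  by simp

text \<open>\<open>A\<close> and its translate have equal measure, hence so have their two one-sided
  differences. This is what makes the random walk symmetric.\<close>

lemma measure_displacement_half:
  "measure Leb {x. x \<in> A \<and> x - e \<notin> A} = displacement A e / 2"
  "measure Leb {x. x \<notin> A \<and> x - e \<in> A} = displacement A e / 2"
proof -
  have "measure Leb {x. x \<in> A \<and> x - e \<notin> A} + measure Leb {x. x \<in> A \<and> x - e \<in> A} = measure Leb A"
    by (subst Leb.finite_measure_Union[symmetric]) (auto intro!: arg_cong[of _ _ "measure Leb"])
  moreover have "measure Leb {x. x \<notin> A \<and> x - e \<in> A} + measure Leb {x. x \<in> A \<and> x - e \<in> A} = measure Leb {x. x - e \<in> A}"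
    by (subst Leb.finite_measure_Union[symmetric]) (auto intro!: arg_cong[of _ _ "measure Leb"])
  moreover have "measure Leb {x. x \<in> A \<and> x - e \<notin> A} + measure Leb {x. x \<notin> A \<and> x - e \<in> A} = displacement A e"
    unfolding displacement_eq
    by (subst Leb.finite_measure_Union[symmetric]) (auto intro!: arg_cong[of _ _ "measure Leb"])
  ultimately show "measure Leb {x. x \<in> A \<and> x - e \<notin> A} = displacement A e / 2"
    "measure Leb {x. x \<notin> A \<and> x - e \<in> A} = displacement A e / 2"
    using measure_Leb_diff[OF A, of e] by simp_all
qed

lemma displacement_Compl: "displacement (- A) e = displacement A e"
  unfolding displacement_eq by (intro arg_cong[of _ _ "measure Leb"]) auto

lemma displacement_le_measure: "displacement A e \<le> 2 * measure Leb A"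
proof -
  have "measure Leb {x. x \<in> A \<and> x - e \<notin> A} \<le> measure Leb A"
    by (intro Leb.finite_measure_mono) auto
  then show ?thesis by (simp add: measure_displacement_half)
qed

end

lemma displacement_Un:
  assumes [measurable]: "A \<in> sets borel" "B \<in> sets borel"
  shows "displacement (A \<union> B) e \<le> displacement A e + displacement B e"
proof -
  have "displacement (A \<union> B) e \<le> measure Leb ({x. (x \<in> A) \<noteq> (x - e \<in> A)} \<union> {x. (x \<in> B) \<noteq> (x - e \<in> B)})"
    unfolding displacement_eq by (intro Leb.finite_measure_mono) auto
  also have "\<dots> \<le> displacement A e + displacement B e"
    unfolding displacement_eq by (intro measure_Un_le) measurable
  finally show ?thesis .
qed

text \<open>Dominated convergence is applied to one half of the symmetric difference only: a point
  of \<open>U\<close> stays in \<open>U\<close> under small shifts. The other half could fail to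
  converge pointwise at boundary points of \<open>U\<close>, which may have positive measure, but it
  has the same measure as the first.\<close>

lemma displacement_open_tendsto_0:
  fixes U :: "'k::finite torus set"
  assumes U: "open U"
  shows "((\<lambda>e. displacement U (to_torus e)) \<longlongrightarrow> 0) (nhds 0)"
proof -
  have [measurable]: "U \<in> sets borel" using U by simp
  have "continuous (at 0) (\<lambda>e. displacement U (to_torus e))"
    unfolding continuous_at_sequentially
  proof (intro allI impI)
    fix E :: "nat \<Rightarrow> real ^ 'k" assume E: "E \<longlonglongrightarrow> 0"
    have "(\<lambda>n. \<integral>x. indicator {x. x \<in> U \<and> x - to_torus (E n) \<notin> U} x \<partial>Leb) \<longlonglongrightarrow> (\<integral>x. (0::real) \<partial>(Leb :: 'k torus measure))"
    proof (rule integral_dominated_convergence[where w="\<lambda>_. 1 :: real"])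
      show "AE x in Leb. (\<lambda>n. indicator {x. x \<in> U \<and> x - to_torus (E n) \<notin> U} x :: real) \<longlonglongrightarrow> 0"
      proof (intro AE_I2 tendsto_eventually)
        fix x :: "'k torus"
        show "\<forall>\<^sub>F n in sequentially. indicator {x. x \<in> U \<and> x - to_torus (E n) \<notin> U} x = (0 :: real)"
        proof (cases "x \<in> U")
          case True
          define y where "y = rep_torus x"
          have "(\<lambda>n. y - E n) \<longlonglongrightarrow> y" using tendsto_diff[OF tendsto_const E] by simp
          moreover have "open (to_torus -` U)" "y \<in> to_torus -` U"
            using U True by (simp_all add: open_torus_def y_def)
          ultimately have "\<forall>\<^sub>F n in sequentially. y - E n \<in> to_torus -` U"
            by (rule topological_tendstoD)
          then show ?thesis
            by eventually_elim (simp add: to_torus_diff y_def)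
        qed simp
      qed
    qed (auto simp: indicator_def)
    then have "(\<lambda>n. 2 * (\<integral>x. indicator {x. x \<in> U \<and> x - to_torus (E n) \<notin> U} x \<partial>Leb)) \<longlonglongrightarrow> 2 * (0::real)"
      by (intro tendsto_intros) simp
    moreover have "2 * (\<integral>x. indicator {x. x \<in> U \<and> x - to_torus (E n) \<notin> U} x \<partial>Leb) = displacement U (to_torus (E n))" for n
      by (simp add: measure_displacement_half)
    ultimately have "(\<lambda>n. displacement U (to_torus (E n))) \<longlonglongrightarrow> 2 * 0"
      by (simp only:)
    then show "((\<lambda>e. displacement U (to_torus e)) \<circ> E) \<longlonglongrightarrow> displacement U (to_torus 0)"
      by (simp add: o_def to_torus_zero)
  qed
  then show ?thesis
    unfolding continuous_at
    using tendsto_at_iff_tendsto_nhds[of "\<lambda>e. displacement U (to_torus e)" 0]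
    by (simp add: to_torus_zero)
qed

text \<open>The sets with this property contain the open sets, an intersection-stable generator, and
  are closed under complements and countable disjoint unions.\<close>

lemma displacement_tendsto_0:
  fixes A :: "'k::finite torus set"
  assumes "A \<in> sets borel"
  shows "((\<lambda>e. displacement A (to_torus e)) \<longlongrightarrow> 0) (nhds 0)"
proof -
  have "Int_stable {S :: 'k torus set. open S}" by (auto simp: Int_stable_def)
  moreover have "{S :: 'k torus set. open S} \<subseteq> Pow UNIV" by simp
  moreover have "A \<in> sigma_sets UNIV {S. open S}" using assms by (simp add: sets_borel_sigma_sets)
  ultimately show ?thesis
  proof (induction rule: sigma_sets_induct_disjoint)
    case (basic A)
    then show ?case by (auto intro: displacement_open_tendsto_0)
  next
    case (compl A)
    then have "A \<in> sets borel" by (simp add: sets_borel_sigma_sets)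
    with compl show ?case by (simp add: displacement_Compl flip: Compl_eq_Diff_UNIV)
  next
    case (union D)
    then have D [measurable]: "D i \<in> sets borel" for i by (auto simp: sets_borel_sigma_sets)
    define W where "W n = (\<Union>i<n. D i)" for n
    have W [measurable]: "W n \<in> sets borel" for n unfolding W_def by measurable
    have lim_W: "((\<lambda>e. displacement (W n) (to_torus e)) \<longlongrightarrow> 0) (nhds 0)" for n
    proof (induction n)
      case 0
      then show ?case by (simp add: W_def displacement_eq)
    next
      case (Suc n)
      have "((\<lambda>e. displacement (W n) (to_torus e) + displacement (D n) (to_torus e)) \<longlongrightarrow> 0 + 0) (nhds 0)"
        by (rule tendsto_add[OF Suc union(3)])
      moreover have "W (Suc n) = W n \<union> D n" by (auto simp: W_def lessThan_Suc)
      ultimately show ?case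
        by - (rule tendsto_sandwich[OF _ _ tendsto_const, of 0 _ _ "\<lambda>e. displacement (W n) (to_torus e) + displacement (D n) (to_torus e)"],
              simp_all add: displacement_nonneg displacement_Un)
    qed
    have "incseq W" unfolding W_def by (intro monoI UN_mono) auto
    then have "(\<lambda>n. measure Leb (W n)) \<longlonglongrightarrow> measure Leb (\<Union>n. W n)"
      by (intro Leb.finite_Lim_measure_incseq) auto
    moreover have UW: "(\<Union>n. W n) = (\<Union>i. D i)" by (auto simp: W_def)
    ultimately have lim: "(\<lambda>n. measure Leb (W n)) \<longlonglongrightarrow> measure Leb (\<Union>i. D i)" by simp
    show ?case
    proof (rule tendstoI)
      fix d :: real assume d: "d > 0"
      obtain n where n: "dist (measure Leb (W n)) (measure Leb (\<Union>i. D i)) < d / 4"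
        using tendstoD[OF lim, of "d / 4"] d by (auto simp: eventually_sequentially)
      have [measurable]: "(\<Union>i. D i) - W n \<in> sets borel" by measurable
      have sub: "W n \<subseteq> (\<Union>i. D i)" by (auto simp: W_def)
      then have "measure Leb ((\<Union>i. D i) - W n) = measure Leb (\<Union>i. D i) - measure Leb (W n)"
        by (intro Leb.finite_measure_Diff) auto
      with n have small: "measure Leb ((\<Union>i. D i) - W n) < d / 4" unfolding dist_real_def by linarith
      \<comment> \<open>The tail of the union contributes at most twice its measure, uniformly in
        the shift.\<close>
      have bound: "displacement (\<Union>i. D i) x < displacement (W n) x + d / 2" for x
      proof -
        have "W n \<union> ((\<Union>i. D i) - W n) = (\<Union>i. D i)" using sub by auto
        then have "displacement (\<Union>i. D i) x \<le> displacement (W n) x + displacement ((\<Union>i. D i) - W n) x"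
          using displacement_Un[OF W[of n] \<open>(\<Union>i. D i) - W n \<in> sets borel\<close>, of x] by metis
        also have "displacement ((\<Union>i. D i) - W n) x \<le> 2 * measure Leb ((\<Union>i. D i) - W n)"
          by (intro displacement_le_measure) simp
        finally show ?thesis using small by simp
      qed
      have "\<forall>\<^sub>F e in nhds 0. dist (displacement (W n) (to_torus e)) 0 < d / 2"
        using tendstoD[OF lim_W, of "d / 2" n] d by simp
      then show "\<forall>\<^sub>F e in nhds 0. dist (displacement (\<Union>i. D i) (to_torus e)) 0 < d"
      proof eventually_elim
        case (elim e)
        then show ?case using bound[of "to_torus e"]
          by (simp add: displacement_nonneg)
      qed
    qed
  qed (simp_all add: displacement_eq)
qed

lemma continuous_on_displacement:
  fixes A :: "'k::finite torus set"
  assumes A: "A \<in> sets borel"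
  shows "continuous_on UNIV (\<lambda>e. displacement A (to_torus e))"
proof -
  have "((\<lambda>y. displacement A (to_torus y)) \<longlongrightarrow> displacement A (to_torus x)) (nhds x)" for x :: "real ^ 'k"
  proof -
    have "((\<lambda>y. y - x) \<longlongrightarrow> x - x) (nhds x)"
      by (rule tendsto_diff[OF filterlim_ident tendsto_const])
    then have "filterlim (\<lambda>y. y - x) (nhds 0) (nhds x)" by simp
    from filterlim_compose[OF displacement_tendsto_0[OF A] this]
    have "((\<lambda>y. displacement A (to_torus y - to_torus x)) \<longlongrightarrow> 0) (nhds x)"
      by (simp add: to_torus_diff)
    then have "((\<lambda>y. displacement A (to_torus y) - displacement A (to_torus x)) \<longlongrightarrow> 0) (nhds x)"
      by (rule Lim_null_comparison[rotated])
         (simp add: displacement_diff_le[OF A])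
    then show ?thesis by (simp add: LIM_zero_iff)
  qed
  then show ?thesis
    by (simp add: continuous_on_def tendsto_at_iff_tendsto_nhds[of "\<lambda>e. displacement A (to_torus e)"])
qed

lemma measurable_displacement [measurable]:
  fixes A :: "'k::finite torus set"
  assumes "A \<in> sets borel"
  shows "displacement A \<in> borel_measurable borel"
proof -
  have [measurable]: "(\<lambda>e. displacement A (to_torus e)) \<in> borel_measurable borel"
    by (intro borel_measurable_continuous_onI continuous_on_displacement assms)
  have "(\<lambda>x. displacement A (to_torus (frac_rep x))) \<in> borel_measurable borel"
    by measurable
  then show ?thesis by simp
qed

section \<open>Minimality and functions invariant under the translation\<close>

lemma displacement_eq_0_if_minimal:
  fixes C :: "'k::finite torus set"
  assumes C: "C \<in> sets borel" and min: "minimal_map (translation v)" and v: "displacement C v = 0"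
  shows "displacement C x = 0"
proof -
  \<comment> \<open>By subadditivity the zeros of the displacement are closed under addition, so the
    whole forward orbit of 0 consists of zeros.\<close>
  have orbit: "displacement C ((translation v ^^ n) 0) = 0" for n
  proof (induction n)
    case (Suc n)
    have "displacement C ((translation v ^^ n) 0 + v) \<le> 0"
      using displacement_add[OF C, of "(translation v ^^ n) 0" v] Suc v by simp
    then show ?case
      using displacement_nonneg[of C "(translation v ^^ n) 0 + v"] by (simp add: translation_def[of v "(translation v ^^ n) 0"])
  qed simp
  \<comment> \<open>Some point of the dense orbit differs from \<open>x\<close> by an
    \<open>e\<close> of displacement less than \<open>d\<close>; subadditivity carries the zero
    there over to \<open>x\<close>.\<close>
  have "displacement C x \<le> 0 + d" if d: "d > 0" for d
  proof -
    have "\<forall>\<^sub>F e in nhds 0. displacement C (to_torus (e :: real ^ 'k)) < d"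
      using order_tendstoD(2)[OF displacement_tendsto_0[OF C] d] .
    then obtain S :: "(real ^ 'k) set" where S: "open S" "0 \<in> S"
      and Sd: "\<And>e. e \<in> S \<Longrightarrow> displacement C (to_torus e) < d"
      by (auto simp: eventually_nhds)
    let ?V = "to_torus ` ((\<lambda>e. rep_torus x + e) ` S)"
    have "open ?V" using S by (intro open_image_to_torus open_translation)
    moreover have "x \<in> ?V" using S(2) by (intro image_eqI[of _ _ "rep_torus x"] image_eqI[of _ _ 0]) auto
    moreover have "x \<in> closure (range (\<lambda>n. (translation v ^^ n) 0))"
      using min by (simp add: minimal_map_def)
    ultimately obtain n where "(translation v ^^ n) 0 \<in> ?V"
      unfolding closure_iff_nhds_not_empty by blast
    then obtain e where e: "e \<in> S" "(translation v ^^ n) 0 = x + to_torus e"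
      by (auto simp: to_torus_add)
    have "displacement C x \<le> displacement C (x + to_torus e) + displacement C (- to_torus e)"
      using displacement_add[OF C, of "x + to_torus e" "- to_torus e"] by simp
    then show ?thesis using orbit[of n] e Sd[of e] by (simp add: displacement_minus[OF C])
  qed
  then have "displacement C x \<le> 0" by (rule field_le_epsilon)
  then show ?thesis using displacement_nonneg[of C x] by simp
qed

text \<open>Superlevel sets at rational heights are invariant under \<open>v\<close> up to null
  sets, hence under every translation, and they determine \<open>h\<close>. So
  \<open>h (x + e) = h x\<close> for almost every \<open>x\<close>, with a null set that depends on
  \<open>e\<close>.\<close>

lemma AE_const_if_invariant:
  fixes h :: "'k::finite torus \<Rightarrow> real"
  assumes min: "minimal_map (translation v)"
    and h [measurable]: "h \<in> borel_measurable borel"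
    and inv: "AE x in Leb. h (x + v) = h x"
  shows "\<exists>c. AE x in Leb. h x = c"
proof -
  have inv': "AE x in Leb. h x = h (x - v)"
    using AE_Leb_add[OF inv, of "- v"] by simp
  have *: "AE x in Leb. h (x + e) = h x" for e
  proof -
    have "AE x in Leb. q < h x \<longleftrightarrow> q < h (x + e)" for q
    proof -
      define C where "C = {x. q < h x}"
      have [measurable]: "C \<in> sets borel" unfolding C_def by measurable
      have "displacement C v = 0"
        unfolding displacement_eq
        by (subst Leb.prob_eq_0) (use inv' in \<open>auto simp: C_def\<close>)
      then have "displacement C (- e) = 0"
        using displacement_eq_0_if_minimal[OF _ min, of C "- e"] by simp
      then have "AE x in Leb. x \<notin> {x. (x \<in> C) \<noteq> (x - - e \<in> C)}"
        unfolding displacement_eq by (subst (asm) Leb.prob_eq_0) auto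
      then show ?thesis by (simp add: C_def)
    qed
    then have "AE x in Leb. \<forall>q :: rat. of_rat q < h x \<longleftrightarrow> of_rat q < h (x + e)"
      by (simp add: AE_all_countable)
    then show ?thesis
    proof eventually_elim
      case (elim x)
      show ?case
      proof (rule ccontr)
        assume "h (x + e) \<noteq> h x"
        then consider "h (x + e) < h x" | "h x < h (x + e)" by linarith
        then show False
        proof cases
          case 1 then show False using elim of_rat_dense[OF 1] by (metis less_asym)
        next
          case 2 then show False using elim of_rat_dense[OF 2] by (metis less_asym)
        qed
      qed
    qed
  qed
  interpret P: pair_prob_space "Leb :: 'k torus measure" "Leb :: 'k torus measure" ..
  \<comment> \<open>Fubini replaces the null sets depending on \<open>e\<close> by a single base
    point \<open>x\<close> that is good for almost all \<open>e\<close>.\<close>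
  have "AE e in Leb. AE x in Leb. h (x + e) = h x" using * by simp
  then have "AE x in Leb. AE e in Leb. h (x + e) = h x"
    by (subst P.AE_commute) measurable
  then obtain x where "AE e in Leb. h (x + e) = h x"
    using eventually_happens'[OF Leb.ae_filter_bot] by blast
  then have "AE e in Leb. h (x + (e + - x)) = h x" by (rule AE_Leb_add)
  then show ?thesis by (intro exI[of _ "h x"]) (simp add: algebra_simps)
qed

subsection \<open>The maximal ergodic inequality\<close>

text \<open>The maximum over \<open>0 \<le> k \<le> n\<close> of the Birkhoff sums \<open>f x + \<dots> + f ((T ^^ k) x)\<close>.\<close>

primrec birkhoff_max :: "('a \<Rightarrow> 'a) \<Rightarrow> ('a \<Rightarrow> real) \<Rightarrow> nat \<Rightarrow> 'a \<Rightarrow> real" where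
  "birkhoff_max T f 0 = f"
| "birkhoff_max T f (Suc n) = (\<lambda>x. f x + max 0 (birkhoff_max T f n (T x)))"

lemma birkhoff_max_mono: "birkhoff_max T f n x \<le> birkhoff_max T f (Suc n) x"
proof (induction n arbitrary: x)
  case (Suc n)
  have "max 0 (birkhoff_max T f n (T x)) \<le> max 0 (birkhoff_max T f (Suc n) (T x))"
    using Suc[of "T x"] by (simp add: max.coboundedI2)
  then show ?case by simp
qed simp

lemma birkhoff_max_ge_0: "f x \<le> birkhoff_max T f n x"
  by (cases n) auto

lemma birkhoff_max_ge_sum: "(\<Sum>j<Suc n. f ((T ^^ j) x)) \<le> birkhoff_max T f n x"
proof (induction n arbitrary: x)
  case (Suc n)
  have "(\<Sum>j<Suc (Suc n). f ((T ^^ j) x)) = f x + (\<Sum>j<Suc n. f ((T ^^ j) (T x)))"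
    by (subst sum.lessThan_Suc_shift) (simp add: funpow_swap1)
  also have "\<dots> \<le> birkhoff_max T f (Suc n) x"
    using Suc[of "T x"] by (simp add: max.coboundedI2)
  finally show ?case .
qed simp

lemma abs_birkhoff_max_le:
  assumes "\<And>x. \<bar>f x\<bar> \<le> C"
  shows "\<bar>birkhoff_max T f n x\<bar> \<le> real (Suc n) * C"
proof (induction n arbitrary: x)
  case 0
  then show ?case using assms by simp
next
  case (Suc n)
  have "\<bar>max 0 (birkhoff_max T f n (T x))\<bar> \<le> real (Suc n) * C"
    using Suc[of "T x"] by (simp add: abs_le_iff max_def del: of_nat_Suc)
  then have "\<bar>f x\<bar> + \<bar>max 0 (birkhoff_max T f n (T x))\<bar> \<le> C + real (Suc n) * C"
    using assms[of x] by linarith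
  also have "\<dots> = real (Suc (Suc n)) * C" by (simp add: algebra_simps)
  finally show ?case using abs_triangle_ineq[of "f x" "max 0 (birkhoff_max T f n (T x))"] by simp
qed

lemma measurable_birkhoff_max:
  assumes [measurable]: "T \<in> measurable M M" "f \<in> borel_measurable M"
  shows "birkhoff_max T f n \<in> borel_measurable M"
  by (induction n) simp_all

text \<open>The event that the supremum of the Birkhoff sums is infinite. It is exactly invariant,
  not only up to null sets, and on it the maxima are eventually positive.\<close>

definition unbounded_sums :: "'a measure \<Rightarrow> ('a \<Rightarrow> 'a) \<Rightarrow> ('a \<Rightarrow> real) \<Rightarrow> 'a set" where
  "unbounded_sums M T f = {x \<in> space M. \<forall>K::nat. \<exists>n. real K < birkhoff_max T f n x}"

lemma measurable_unbounded_sums [measurable]: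
  assumes [measurable]: "T \<in> measurable M M" "f \<in> borel_measurable M"
  shows "unbounded_sums M T f \<in> sets M"
proof -
  note [measurable] = measurable_birkhoff_max[OF assms]
  show ?thesis unfolding unbounded_sums_def by measurable
qed

text \<open>One application of \<open>T\<close> changes the maxima by at most a bounded summand,
  apart from the truncation at 0; raising the threshold \<open>K\<close> by \<open>L\<close> absorbs
  this.\<close>

lemma unbounded_sums_invariant:
  assumes T: "T \<in> measurable M M" and C: "\<And>x. \<bar>f x\<bar> \<le> C" and x: "x \<in> space M"
  shows "T x \<in> unbounded_sums M T f \<longleftrightarrow> x \<in> unbounded_sums M T f"
proof -
  obtain L :: nat where L: "C \<le> real L" using real_arch_simple by blast
  have Tx: "T x \<in> space M" using T x by (rule measurable_space)
  have fx: "f x \<le> real L" "- real L \<le> f x" using C[of x] L by auto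
  have "\<exists>n. real K < birkhoff_max T f n (T x)"
    if unb: "\<forall>K::nat. \<exists>n. real K < birkhoff_max T f n x" for K :: nat
  proof -
    obtain n where "real (K + L) < birkhoff_max T f n x" using spec[OF unb, of "K + L"] ..
    also have "\<dots> \<le> f x + max 0 (birkhoff_max T f n (T x))"
      using birkhoff_max_mono[of T f n x] by simp
    finally have "real K < max 0 (birkhoff_max T f n (T x))" using fx by simp
    then have "real K < birkhoff_max T f n (T x)" by (simp add: max_def split: if_splits)
    then show ?thesis ..
  qed
  moreover have "\<exists>n. real K < birkhoff_max T f n x"
    if unb: "\<forall>K::nat. \<exists>n. real K < birkhoff_max T f n (T x)" for K :: nat
  proof -
    obtain n where "real (K + L) < birkhoff_max T f n (T x)" using spec[OF unb, of "K + L"] ..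
    then have "real K < birkhoff_max T f (Suc n) x" using fx by (simp add: max_def)
    then show ?thesis ..
  qed
  ultimately show ?thesis using x Tx unfolding unbounded_sums_def by blast
qed

text \<open>Write F n for the maxima and E for the event. Since max 0 t = t + max 0 (-t), F (n+1) is
  the sum of f, F n composed with T, and the negative part of the latter. Integrate over the
  invariant set E: by monotonicity of F n and invariance of the measure, the integral of f over E
  plus that of the negative part is nonnegative. The negative parts tend to 0 on E.\<close>

lemma (in prob_space) integral_unbounded_sums_nonneg:
  assumes T [measurable]: "T \<in> measurable M M" and inv: "distr M M T = M"
    and f [measurable]: "f \<in> borel_measurable M" and C: "\<And>x. \<bar>f x\<bar> \<le> C"
  shows "0 \<le> (\<integral>x. indicator (unbounded_sums M T f) x * f x \<partial>M)"
proof -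
  let ?E = "unbounded_sums M T f"
  let ?F = "birkhoff_max T f"
  let ?r = "\<lambda>n x. indicator ?E x * max 0 (- ?F n (T x))"
  note [measurable] = measurable_birkhoff_max[OF T f]
  have C0: "0 \<le> C" using C[of undefined] by linarith
  have int_F: "integrable M (\<lambda>x. indicator ?E x * ?F n x)" for n
    by (rule integrable_const_bound[of _ "real (Suc n) * C"])
       (auto simp: indicator_def abs_birkhoff_max_le[OF C] C0 simp del: of_nat_Suc)
  have int_FT: "integrable M (\<lambda>x. indicator ?E x * ?F n (T x))" for n
    by (rule integrable_const_bound[of _ "real (Suc n) * C"])
       (auto simp: indicator_def abs_birkhoff_max_le[OF C] C0 simp del: of_nat_Suc)
  have int_f: "integrable M (\<lambda>x. indicator ?E x * f x)"
    by (rule integrable_const_bound[of _ C]) (auto simp: indicator_def C C0)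
  \<comment> \<open>The bound is uniform in \<open>n\<close>, because the maxima are at least
    \<open>f\<close>, hence at least \<open>- C\<close>; this gives dominated convergence
    below.\<close>
  have r_le: "norm (?r n x) \<le> C" for n x
    using birkhoff_max_ge_0[of f "T x" T n] C[of "T x"] C0 by (auto simp: indicator_def)
  have int_r: "integrable M (?r n)" for n
    by (rule integrable_const_bound[of _ C]) (use r_le in auto)
  have "0 \<le> (\<integral>x. indicator ?E x * f x \<partial>M) + (\<integral>x. ?r n x \<partial>M)" for n
  proof -
    have "(\<integral>x. indicator ?E x * ?F n x \<partial>M) = (\<integral>x. indicator ?E x * ?F n x \<partial>distr M M T)"
      by (simp add: inv)
    also have "\<dots> = (\<integral>x. indicator ?E (T x) * ?F n (T x) \<partial>M)"
      by (rule integral_distr) measurable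
    also have "\<dots> = (\<integral>x. indicator ?E x * ?F n (T x) \<partial>M)"
      by (intro Bochner_Integration.integral_cong refl)
         (simp add: indicator_def unbounded_sums_invariant[OF T C])
    finally have eq: "(\<integral>x. indicator ?E x * ?F n x \<partial>M) = (\<integral>x. indicator ?E x * ?F n (T x) \<partial>M)" .
    have "(\<integral>x. indicator ?E x * ?F n x \<partial>M) \<le> (\<integral>x. indicator ?E x * ?F (Suc n) x \<partial>M)"
      by (intro integral_mono int_F mult_left_mono birkhoff_max_mono) simp
    also have "\<dots> = (\<integral>x. indicator ?E x * f x + (indicator ?E x * ?F n (T x) + ?r n x) \<partial>M)"
      by (intro Bochner_Integration.integral_cong refl) (auto simp: indicator_def max_def)
    also have "\<dots> = (\<integral>x. indicator ?E x * f x \<partial>M) + ((\<integral>x. indicator ?E x * ?F n (T x) \<partial>M) + (\<integral>x. ?r n x \<partial>M))"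
      by (simp only: Bochner_Integration.integral_add int_f int_FT int_r Bochner_Integration.integrable_add)
    finally show ?thesis unfolding eq by simp
  qed
  moreover have "(\<lambda>n. \<integral>x. ?r n x \<partial>M) \<longlonglongrightarrow> (\<integral>x. 0 \<partial>M)"
  proof (rule integral_dominated_convergence[where w="\<lambda>_. C"])
    show "AE x in M. (\<lambda>n. ?r n x) \<longlonglongrightarrow> 0"
    proof (intro AE_I2 tendsto_eventually)
      fix x assume x: "x \<in> space M"
      show "\<forall>\<^sub>F n in sequentially. ?r n x = 0"
      proof (cases "x \<in> ?E")
        case True
        then have "T x \<in> ?E" using unbounded_sums_invariant[OF T C x] by simp
        then obtain n where n: "0 < ?F n (T x)"
          unfolding unbounded_sums_def by (auto dest: spec[of _ 0])
        have "0 < ?F m (T x)" if "n \<le> m" for m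
          using lift_Suc_mono_le[of "\<lambda>n. ?F n (T x)", OF birkhoff_max_mono that] n by linarith
        then show ?thesis
          unfolding eventually_sequentially by (intro exI[of _ n]) (simp add: less_imp_le)
      qed simp
    qed
  qed (use r_le in auto)
  then have "(\<lambda>n. (\<integral>x. indicator ?E x * f x \<partial>M) + (\<integral>x. ?r n x \<partial>M)) \<longlonglongrightarrow> (\<integral>x. indicator ?E x * f x \<partial>M) + 0"
    by (intro tendsto_intros) simp
  ultimately show ?thesis
    by (intro LIMSEQ_le_const[of _ "\<integral>x. indicator ?E x * f x \<partial>M"]) auto
qed

subsection \<open>Integrability of the reciprocal displacement\<close>

text \<open>Used at 0, the only zero of the displacement of \<open>A\<close>: the reciprocal is
  finite almost everywhere.\<close>

lemma emeasure_Leb_singleton: "emeasure Leb {a :: 'k::finite torus} = 0"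
proof -
  have "emeasure Leb {a} = emeasure lborel {x. x - 0 \<in> unit_cube \<and> to_torus x \<in> {a}}"
    by (rule emeasure_Leb_cube) simp
  also have "\<dots> \<le> emeasure lborel {frac_rep a}"
  proof (intro emeasure_mono subsetI)
    fix x assume x: "x \<in> {x. x - 0 \<in> unit_cube \<and> to_torus x \<in> {a}}"
    then have "frac_rep a $ i = x $ i" for i
      by (auto simp: frac_rep_to_torus frac_eq unit_cube_def)
    then show "x \<in> {frac_rep a}" by (simp add: vec_eq_iff)
  qed simp
  finally show ?thesis by simp
qed

lemma AE_Leb_neq: "AE x in Leb. x \<noteq> (a :: 'k::finite torus)"
  by (rule AE_I[of _ _ "{a}"]) (auto simp: emeasure_Leb_singleton)

lemma displacement_annulus_pos:
  fixes A :: "'k::finite torus set"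
  assumes A: "A \<in> sets borel" and sym: "no_translational_symmetries A"
  obtains m where "m > 0"
    "\<And>e i. (\<And>i. \<bar>e $ i\<bar> \<le> 1/2) \<Longrightarrow> 1/4 \<le> \<bar>e $ i\<bar> \<Longrightarrow> m \<le> displacement A (to_torus e)"
proof -
  \<comment> \<open>The inner radius is half the outer one, so that doubling a vector from inside
    the annulus cannot jump over it. No vector in \<open>?K\<close> is integral, hence the
    continuous displacement has a positive minimum there.\<close>
  let ?K = "{e :: real ^ 'k. (\<forall>i. \<bar>e $ i\<bar> \<le> 1/2) \<and> (\<exists>i. 1/4 \<le> \<bar>e $ i\<bar>)}"
  have "?K = (\<Inter>i. {e. \<bar>e $ i\<bar> \<le> 1/2}) \<inter> (\<Union>i. {e. 1/4 \<le> \<bar>e $ i\<bar>})" by auto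
  also have "closed \<dots>"
    by (intro closed_Int closed_INT closed_UN closed_Collect_le continuous_intros ballI) auto
  finally have "closed ?K" .
  moreover have "?K \<subseteq> cbox (\<chi> i. - 1/2) (\<chi> i. 1/2)"
  proof
    fix e assume "e \<in> ?K"
    then have e: "\<bar>e $ i\<bar> \<le> 1/2" for i by blast
    have "- 1/2 \<le> e $ i \<and> e $ i \<le> 1/2" for i using e[of i] by linarith
    then show "e \<in> cbox (\<chi> i. - 1/2) (\<chi> i. 1/2)" by (simp add: mem_box_cart)
  qed
  then have "bounded ?K" using bounded_cbox bounded_subset by blast
  ultimately have "compact ?K" by (simp add: compact_eq_bounded_closed)
  moreover have "?K \<noteq> {}" by (auto intro!: exI[of _ "\<chi> i. 1/4"])
  moreover have "continuous_on ?K (\<lambda>e. displacement A (to_torus e))"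
    by (rule continuous_on_subset[OF continuous_on_displacement[OF A]]) simp
  ultimately obtain e where e: "e \<in> ?K"
    and min: "\<And>y. y \<in> ?K \<Longrightarrow> displacement A (to_torus e) \<le> displacement A (to_torus y)"
    using continuous_attains_inf[of ?K "\<lambda>e. displacement A (to_torus e)"] by blast
  have "to_torus e \<noteq> 0"
  proof
    assume "to_torus e = 0"
    then have int: "e $ i \<in> \<int>" for i
      by (simp add: to_torus_eq_iff flip: to_torus_zero)
    obtain i where i: "1/4 \<le> \<bar>e $ i\<bar>" "\<bar>e $ i\<bar> \<le> 1/2" using e by auto
    obtain n where n: "e $ i = of_int n" using int[of i] by (auto elim: Ints_cases)
    have "\<bar>real_of_int n\<bar> < 1" using i(2) unfolding n by linarith
    then have "n = 0" by linarith
    with i(1) n show False by simp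
  qed
  then have "0 < displacement A (to_torus e)"
    using sym displacement_nonneg[of A "to_torus e"]
    by (simp add: no_translational_symmetries_def less_le)
  with min show ?thesis by (intro that[of "displacement A (to_torus e)"]) auto
qed

text \<open>Doubling: if \<open>e\<close> has small displacement, then so have \<open>2 e, 4 e, \<dots>\<close> by subadditivity,
  so that none of these multiples reaches the annulus.\<close>

lemma displacement_small_imp_small:
  fixes A :: "'k::finite torus set"
  assumes A: "A \<in> sets borel" and m: "m > 0"
    and annulus: "\<And>e i. (\<And>i. \<bar>e $ i\<bar> \<le> 1/2) \<Longrightarrow> 1/4 \<le> \<bar>e $ i\<bar> \<Longrightarrow> m \<le> displacement A (to_torus e)"
    and e: "\<And>i. \<bar>e $ i\<bar> \<le> 1/2" "displacement A (to_torus e) < m / 2 ^ j"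
  shows "\<bar>e $ i\<bar> < 1 / (4 * 2 ^ j)"
  using e
proof (induction j arbitrary: e i)
  case 0
  then show ?case using annulus[of e i] by force
next
  case (Suc j)
  have "m / 2 ^ Suc j \<le> m / 1" using m by (intro divide_left_mono one_le_power) auto
  then have "displacement A (to_torus e) < m" using Suc.prems(2) by linarith
  then have small: "\<bar>e $ i\<bar> < 1/4" for i using annulus[of e i] Suc.prems(1) by force
  have "displacement A (to_torus (e + e)) \<le> displacement A (to_torus e) + displacement A (to_torus e)"
    unfolding to_torus_add by (rule displacement_add[OF A])
  also have "\<dots> < m / 2 ^ j" using Suc.prems(2) by (simp add: field_simps)
  finally have "displacement A (to_torus (e + e)) < m / 2 ^ j" .
  moreover have "\<bar>(e + e) $ i\<bar> \<le> 1/2" for i using small[of i] by simp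
  ultimately have "\<bar>(e + e) $ i\<bar> < 1 / (4 * 2 ^ j)" by (intro Suc.IH)
  then show ?case by (simp add: abs_mult field_simps)
qed

lemma emeasure_cube:
  assumes "0 \<le> r"
  shows "emeasure lborel (cbox (\<chi> i. - r) (\<chi> i. r) :: (real ^ 'k::finite) set) = ennreal ((2 * r) ^ CARD('k))"
proof -
  have eq: "((\<chi> i. r) - (\<chi> i. - r) :: real ^ 'k) \<bullet> b = 2 * r" if "b \<in> Basis" for b
    using that by (auto simp: Basis_vec_def inner_axis)
  have le: "(\<chi> i. - r) \<bullet> b \<le> (\<chi> i. r) \<bullet> b" if "b \<in> Basis" for b :: "real ^ 'k"
    using that assms by (auto simp: Basis_vec_def inner_axis)
  have "(\<Prod>b\<in>Basis. ((\<chi> i. r) - (\<chi> i. - r) :: real ^ 'k) \<bullet> b) = (2 * r) ^ CARD('k)"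
    by (subst prod.cong[OF refl eq]) simp_all
  then show ?thesis using emeasure_lborel_cbox[OF le] by simp
qed

lemma emeasure_displacement_small:
  fixes A :: "'k::finite torus set"
  assumes k: "CARD('k) > 1" and A [measurable]: "A \<in> sets borel" and m: "m > 0"
    and annulus: "\<And>e i. (\<And>i. \<bar>e $ i\<bar> \<le> 1/2) \<Longrightarrow> 1/4 \<le> \<bar>e $ i\<bar> \<Longrightarrow> m \<le> displacement A (to_torus e)"
  shows "emeasure Leb {x. displacement A x < m / 2 ^ j} \<le> ennreal ((1/4) ^ Suc j)"
proof -
  define r :: real where "r = 1 / (4 * 2 ^ j)"
  have "(1::real) \<le> 2 ^ j" by simp
  then have r: "0 \<le> r" "2 * r \<le> 1" by (auto simp: r_def divide_le_eq simp del: one_le_power)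
  \<comment> \<open>This shift selects the centred cube as fundamental domain, where the annulus
    estimate applies.\<close>
  let ?a = "(\<chi> i. - 1/2) :: real ^ 'k"
  note [measurable] = measurable_displacement[OF A]
  have "emeasure Leb {x. displacement A x < m / 2 ^ j} =
      emeasure lborel {e. e - ?a \<in> unit_cube \<and> to_torus e \<in> {x. displacement A x < m / 2 ^ j}}"
    by (rule emeasure_Leb_cube) measurable
  also have "\<dots> \<le> emeasure lborel (cbox (\<chi> i. - r) (\<chi> i. r) :: (real ^ 'k) set)"
  proof (intro emeasure_mono subsetI)
    fix e assume "e \<in> {e. e - ?a \<in> unit_cube \<and> to_torus e \<in> {x. displacement A x < m / 2 ^ j}}"
    then have e: "e - ?a \<in> unit_cube" "displacement A (to_torus e) < m / 2 ^ j" by auto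
    have "\<bar>e $ i\<bar> \<le> 1/2" for i using e(1)
      by (auto simp: unit_cube_def abs_le_iff dest!: spec[of _ i])
    then have "\<bar>e $ i\<bar> < r" for i
      unfolding r_def by (intro displacement_small_imp_small[OF A m annulus _ e(2)])
    then have "- r \<le> e $ i \<and> e $ i \<le> r" for i by (smt (verit))
    then show "e \<in> cbox (\<chi> i. - r) (\<chi> i. r)" by (simp add: mem_box_cart)
  qed simp
  also have "\<dots> = ennreal ((2 * r) ^ CARD('k))" by (rule emeasure_cube[OF r(1)])
  \<comment> \<open>Here the dimension enters: the side \<open>2 * r\<close> is at most 1, so a
    power of at least 2 is bounded by the square.\<close>
  also have "\<dots> \<le> ennreal ((2 * r) ^ 2)"
    using k r by (intro ennreal_leI power_decreasing) auto
  also have "(2 * r) ^ 2 = (1/4) ^ Suc j"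
    by (simp add: r_def power2_eq_square power_divide flip: power_mult_distrib)
  finally show ?thesis .
qed

lemma inv_displacement_pos: "0 < inv_displacement A x"
  by (simp add: inv_displacement_def ennreal_zero_less_divide)

lemma inv_displacement_eq: "0 < displacement A x \<Longrightarrow> inv_displacement A x = ennreal (1 / displacement A x)"
  by (simp add: inv_displacement_def divide_ennreal flip: ennreal_1)

lemma one_le_inv_displacement: "1 \<le> inv_displacement A x"
proof (cases "displacement A x = 0")
  case True
  then show ?thesis by (simp add: inv_displacement_def)
next
  case False
  then have "0 < displacement A x" using displacement_nonneg[of A x] by simp
  then show ?thesis using displacement_le_1[of A x]
    by (simp add: inv_displacement_eq)
qed

text \<open>Split dyadically by the size of the displacement. On layer \<open>j\<close> the
  reciprocal is at most \<open>2 ^ Suc j / m\<close>, while the layer has measure at most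
  \<open>(1/4) ^ Suc j\<close>, so the sum is geometric. A measure bound of order 2^-j would not
  suffice.\<close>

lemma norm_const_finite:
  fixes A :: "'k::finite torus set"
  assumes k: "CARD('k) > 1" and A [measurable]: "A \<in> sets borel"
    and sym: "no_translational_symmetries A"
  shows "norm_const A < \<infinity>"
proof -
  obtain m where m: "m > 0" and annulus:
    "\<And>e i. (\<And>i. \<bar>e $ i\<bar> \<le> 1/2) \<Longrightarrow> 1/4 \<le> \<bar>e $ i\<bar> \<Longrightarrow> m \<le> displacement A (to_torus e)"
    using displacement_annulus_pos[OF A sym] by blast
  note [measurable] = measurable_displacement[OF A]
  let ?g = "\<lambda>j x. ennreal (2 ^ Suc j / m) * indicator {x. displacement A x < m / 2 ^ j} x"
  have "inv_displacement A x \<le> ennreal (1 / m) + (\<Sum>j. ?g j x)" if "x \<noteq> 0" for x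
  proof -
    have pos: "0 < displacement A x"
      using that sym displacement_nonneg[of A x] by (simp add: no_translational_symmetries_def less_le)
    show ?thesis
    proof (cases "m \<le> displacement A x")
      case True
      then have "ennreal (1 / displacement A x) \<le> ennreal (1 / m)"
        using m pos by (intro ennreal_leI divide_left_mono) auto
      then show ?thesis unfolding inv_displacement_eq[OF pos]
        by (rule order_trans) simp
    next
      case False
      have "\<exists>n. m / 2 ^ n \<le> displacement A x"
      proof -
        obtain n where "m / displacement A x < 2 ^ n"
          using real_arch_pow[of 2 "m / displacement A x"] by auto
        then show ?thesis using pos by (intro exI[of _ n]) (simp add: field_simps)
      qed
      \<comment> \<open>The least such \<open>n\<close> locates the layer of \<open>x\<close>: it is
        a successor \<open>Suc j\<close> because the displacement is below \<open>m\<close>, and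
        \<open>j\<close> still fails.\<close>
      define n where "n = (LEAST n. m / 2 ^ n \<le> displacement A x)"
      have n: "m / 2 ^ n \<le> displacement A x"
        unfolding n_def using \<open>\<exists>n. _\<close> by (rule LeastI_ex)
      with False have "n \<noteq> 0" by (intro notI) simp
      then obtain j where j: "n = Suc j" by (cases n) auto
      have "\<not> m / 2 ^ j \<le> displacement A x"
        using not_less_Least[of j "\<lambda>n. m / 2 ^ n \<le> displacement A x"] j n_def by simp
      then have "?g j x = ennreal (2 ^ Suc j / m)" by simp
      moreover have "1 / displacement A x \<le> 2 ^ Suc j / m"
        using n[unfolded j] pos m by (simp add: field_simps)
      ultimately have "ennreal (1 / displacement A x) \<le> ?g j x"
        by (simp only: ennreal_leI)
      also have "?g j x \<le> (\<Sum>j. ?g j x)"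
      proof -
        have "(\<Sum>i\<in>{j}. ?g i x) \<le> (\<Sum>j. ?g j x)" by (rule sum_le_suminf) auto
        then show ?thesis by (simp only: sum.insert sum.empty finite.emptyI empty_iff not_False_eq_True add_0_right)
      qed
      finally show ?thesis unfolding inv_displacement_eq[OF pos]
        by (rule order_trans) simp
    qed
  qed
  then have "norm_const A \<le> (\<integral>\<^sup>+x. ennreal (1 / m) + (\<Sum>j. ?g j x) \<partial>Leb)"
    unfolding norm_const_def using AE_Leb_neq[of 0] by (intro nn_integral_mono_AE) auto
  also have "\<dots> = (\<integral>\<^sup>+x. ennreal (1 / m) \<partial>(Leb :: 'k torus measure)) + (\<integral>\<^sup>+x. (\<Sum>j. ?g j x) \<partial>Leb)"
    by (rule nn_integral_add) measurable
  also have "(\<integral>\<^sup>+x. ennreal (1 / m) \<partial>(Leb :: 'k torus measure)) = ennreal (1 / m)"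
    using Leb.emeasure_space_1[where 'k='k] by simp
  also have "(\<integral>\<^sup>+x. (\<Sum>j. ?g j x) \<partial>Leb) = (\<Sum>j. \<integral>\<^sup>+x. ?g j x \<partial>Leb)"
    by (rule nn_integral_suminf) measurable
  also have "(\<lambda>j. \<integral>\<^sup>+x. ?g j x \<partial>Leb) = (\<lambda>j. ennreal (2 ^ Suc j / m) * emeasure Leb {x. displacement A x < m / 2 ^ j})"
    by (intro ext nn_integral_cmult_indicator) measurable
  also have "ennreal (1 / m) + suminf \<dots> \<le> ennreal (1 / m) + (\<Sum>j. ennreal (1 / (2 * m) * (1 / 2) ^ j))"
  proof (intro add_left_mono suminf_le summableI)
    fix j
    have "ennreal (2 ^ Suc j / m) * emeasure Leb {x. displacement A x < m / 2 ^ j}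
        \<le> ennreal (2 ^ Suc j / m) * ennreal ((1/4) ^ Suc j)"
      by (intro mult_left_mono emeasure_displacement_small[OF k A m annulus]) auto
    also have "\<dots> = ennreal (2 ^ Suc j / m * (1/4) ^ Suc j)"
      using m by (intro ennreal_mult[symmetric]) auto
    also have "2 ^ Suc j / m * (1/4) ^ Suc j = 1 / (2 * m) * (1 / 2) ^ j"
    proof -
      have "(2::real) ^ Suc j * (1/4) ^ Suc j = (1/2) ^ Suc j"
        by (simp only: flip: power_mult_distrib) simp
      then show ?thesis using m by (simp add: field_simps)
    qed
    finally show "ennreal (2 ^ Suc j / m) * emeasure Leb {x. displacement A x < m / 2 ^ j}
        \<le> ennreal (1 / (2 * m) * (1 / 2) ^ j)" .
  qed
  also have "(\<Sum>j. ennreal (1 / (2 * m) * (1 / 2) ^ j)) = ennreal (\<Sum>j. 1 / (2 * m) * (1 / 2) ^ j)"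
    using m by (intro suminf_ennreal2 summable_mult summable_geometric) auto
  also have "ennreal (1 / m) + \<dots> < \<infinity>" by simp
  finally show ?thesis .
qed

lemma norm_const_ge_1:
  fixes A :: "'k::finite torus set"
  shows "1 \<le> norm_const A"
proof -
  have "(\<integral>\<^sup>+x. 1 \<partial>(Leb :: 'k torus measure)) \<le> norm_const A"
    unfolding norm_const_def by (intro nn_integral_mono one_le_inv_displacement)
  then show ?thesis using Leb.emeasure_space_1[where 'k='k] by simp
qed

section \<open>The normalized measure and its null sets\<close>

lemma nn_integral_mu_bar:
  fixes A :: "'k::finite torus set"
  assumes [measurable]: "A \<in> sets borel" "f \<in> borel_measurable borel"
  shows "(\<integral>\<^sup>+x. f x \<partial>mu_bar A) = 1 / norm_const A * (\<integral>\<^sup>+x. inv_displacement A x * f x \<partial>Leb)"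
proof -
  have [measurable]: "inv_displacement A \<in> borel_measurable borel"
    unfolding inv_displacement_def using measurable_displacement[OF assms(1)] by measurable
  show ?thesis
    unfolding mu_bar_def by (subst nn_integral_scale_measure) (simp_all add: nn_integral_density)
qed

lemma sets_mu_bar [measurable_cong, simp]: "sets (mu_bar A) = sets borel"
  and space_mu_bar [simp]: "space (mu_bar A) = UNIV"
  by (simp_all add: mu_bar_def space_scale_measure)

text \<open>The density is positive everywhere, and so is the normalizing factor because the total
  mass is finite.\<close>

lemma AE_mu_bar_iff:
  fixes A :: "'k::finite torus set"
  assumes A [measurable]: "A \<in> sets borel" and fin: "norm_const A < \<infinity>"
  shows "(AE x in mu_bar A. P x) \<longleftrightarrow> (AE x in Leb. P x)"
proof -
  have [measurable]: "inv_displacement A \<in> borel_measurable borel"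
    unfolding inv_displacement_def using measurable_displacement[OF A] by measurable
  have pos: "0 < 1 / norm_const A"
    using fin by (simp add: ennreal_zero_less_divide)
  have eq: "mu_bar A = density Leb (\<lambda>x. 1 / norm_const A * inv_displacement A x)"
  proof (rule measure_eqI)
    fix B assume "B \<in> sets (mu_bar A)"
    then have [measurable]: "B \<in> sets borel" by simp
    show "emeasure (mu_bar A) B = emeasure (density Leb (\<lambda>x. 1 / norm_const A * inv_displacement A x)) B"
      by (simp add: mu_bar_def emeasure_density nn_integral_cmult mult.assoc)
  qed simp
  have "0 < 1 / norm_const A * inv_displacement A x" for x
    using pos inv_displacement_pos[of A x] by (simp only: ennreal_zero_less_mult_iff)
  moreover have "(\<lambda>x. 1 / norm_const A * inv_displacement A x) \<in> borel_measurable Leb" by measurable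
  ultimately show ?thesis unfolding eq by (subst AE_density) (simp_all only: simp_thms)
qed

lemma prob_space_mu_bar:
  fixes A :: "'k::finite torus set"
  assumes A: "A \<in> sets borel" and fin: "norm_const A < \<infinity>"
  shows "prob_space (mu_bar A)"
proof
  have "emeasure (mu_bar A) (space (mu_bar A)) = (\<integral>\<^sup>+x. 1 \<partial>mu_bar A)" by simp
  also have "\<dots> = 1 / norm_const A * norm_const A"
    by (subst nn_integral_mu_bar[OF A]) (simp_all add: norm_const_def)
  also have "\<dots> = 1"
    using fin norm_const_ge_1[of A]
    by (simp add: ennreal_divide_times ennreal_divide_self less_top not_one_le_zero)
       (metis ennreal_divide_self not_one_le_zero zero_less_iff_neq_zero top.not_eq_extremum infinity_ennreal_def)
  finally show "emeasure (mu_bar A) (space (mu_bar A)) = 1" .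
qed

subsection \<open>The random walk of the difference\<close>

text \<open>Here \<open>u\<close> is the position of the first point and \<open>u - z\<close> that
  of the second; the noise, common to both, cancels in the difference.\<close>

definition move :: "'k::finite torus set \<Rightarrow> 'k torus \<Rightarrow> 'k torus \<Rightarrow> 'k torus \<Rightarrow> 'k torus" where
  "move A v z u = z + (if u \<in> A then v else 0) - (if u - z \<in> A then v else 0)"

lemma measurable_move [measurable]:
  fixes f g :: "'a \<Rightarrow> 'k::finite torus"
  assumes [measurable]: "A \<in> sets borel" "f \<in> borel_measurable M" "g \<in> borel_measurable M"
  shows "(\<lambda>x. move A v (f x) (g x)) \<in> borel_measurable M"
  unfolding move_def by measurable

text \<open>For fixed \<open>z\<close> the integrand takes three values on Borel sets of
  \<open>u\<close>, so the formula holds for every \<open>F\<close>. At \<open>z = 0\<close> both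
  jump weights vanish.\<close>

lemma nn_integral_move:
  fixes A :: "'k::finite torus set"
  assumes A [measurable]: "A \<in> sets borel"
  shows "(\<integral>\<^sup>+u. F (move A v z u) \<partial>Leb) =
    F z * ennreal (1 - displacement A z) + F (z + v) * ennreal (displacement A z / 2)
      + F (z - v) * ennreal (displacement A z / 2)"
proof -
  let ?S = "{u. (u \<in> A) = (u - z \<in> A)}"
  let ?P = "{u. u \<in> A \<and> u - z \<notin> A}" and ?N = "{u. u \<notin> A \<and> u - z \<in> A}"
  have "?S = UNIV - {u. (u \<in> A) \<noteq> (u - z \<in> A)}" by auto
  then have "measure Leb ?S = 1 - displacement A z"
    unfolding displacement_eq by (simp add: Leb.prob_compl[simplified])
  then have S: "emeasure Leb ?S = ennreal (1 - displacement A z)"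
    by (simp add: Leb.emeasure_eq_measure)
  have P: "emeasure Leb ?P = ennreal (displacement A z / 2)" "emeasure Leb ?N = ennreal (displacement A z / 2)"
    unfolding Leb.emeasure_eq_measure measure_displacement_half[OF A] by simp_all
  have "(\<integral>\<^sup>+u. F (move A v z u) \<partial>Leb) =
      (\<integral>\<^sup>+u. F z * indicator ?S u + F (z + v) * indicator ?P u + F (z - v) * indicator ?N u \<partial>Leb)"
    by (intro nn_integral_cong) (auto simp: move_def indicator_def)
  also have "\<dots> = F z * emeasure Leb ?S + F (z + v) * emeasure Leb ?P + F (z - v) * emeasure Leb ?N"
    by (simp add: nn_integral_add nn_integral_cmult_indicator)
  finally show ?thesis unfolding S P .
qed

text \<open>The density cancels the jump rate: each jump carries the constant weight 1/2, and
  translation invariance of \<open>Leb\<close> turns the two jump terms into one integral of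
  \<open>F\<close>. Together with the holding weight this restores the density, as (1 - d)/d + 1 =
  1/d.\<close>

lemma nn_integral_mu_bar_move:
  fixes A :: "'k::finite torus set"
  assumes A [measurable]: "A \<in> sets borel" and sym: "no_translational_symmetries A"
    and F [measurable]: "F \<in> borel_measurable borel"
  shows "(\<integral>\<^sup>+z. \<integral>\<^sup>+u. F (move A v z u) \<partial>Leb \<partial>mu_bar A) = (\<integral>\<^sup>+z. F z \<partial>mu_bar A)"
proof -
  note [measurable] = measurable_displacement[OF A]
  have [measurable]: "inv_displacement A \<in> borel_measurable borel"
    unfolding inv_displacement_def by measurable
  let ?d = "displacement A"
  let ?r = "\<lambda>z. ennreal ((1 - ?d z) / ?d z)"
  let ?I = "\<integral>\<^sup>+z. F z \<partial>Leb"
  \<comment> \<open>The cancellation fails at 0, where the reciprocal is infinite and the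
    displacement zero.\<close>
  have pos: "AE z in Leb. 0 < ?d z"
    using AE_Leb_neq[of 0]
  proof eventually_elim
    case (elim z)
    then show ?case using sym displacement_nonneg[of A z] by (simp add: no_translational_symmetries_def less_le)
  qed
  have "(\<integral>\<^sup>+z. inv_displacement A z * (\<integral>\<^sup>+u. F (move A v z u) \<partial>Leb) \<partial>Leb) =
      (\<integral>\<^sup>+z. F z * ?r z + (F (z + v) * ennreal (1/2) + F (z + - v) * ennreal (1/2)) \<partial>Leb)"
    using pos
  proof (intro nn_integral_cong_AE, eventually_elim)
    case (elim z)
    then have d: "?d z \<noteq> 0" "0 < ?d z" "?d z \<le> 1" using displacement_le_1[of A z] by auto
    have half: "inv_displacement A z * (x * ennreal (?d z / 2)) = x * ennreal (1/2)" for x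
    proof -
      have "inv_displacement A z * ennreal (?d z / 2) = ennreal (1/2)"
        using d by (simp add: inv_displacement_eq flip: ennreal_mult)
      then show ?thesis by (metis mult.left_commute)
    qed
    have stay: "inv_displacement A z * (x * ennreal (1 - ?d z)) = x * ?r z" for x
    proof -
      have "inv_displacement A z * ennreal (1 - ?d z) = ?r z"
        using d by (simp add: inv_displacement_eq flip: ennreal_mult)
      then show ?thesis by (metis mult.left_commute)
    qed
    show ?case
      unfolding nn_integral_move[OF A] distrib_left half stay by (simp add: add.assoc)
  qed
  also have "\<dots> = (\<integral>\<^sup>+z. F z * ?r z \<partial>Leb) + ((\<integral>\<^sup>+z. F (z + v) \<partial>Leb) * ennreal (1/2) + (\<integral>\<^sup>+z. F (z + - v) \<partial>Leb) * ennreal (1/2))"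
  proof -
    have [measurable]: "(\<lambda>z. F (z + w)) \<in> borel_measurable Leb" for w by measurable
    have "(\<integral>\<^sup>+z. F (z + v) * ennreal (1/2) + F (z + - v) * ennreal (1/2) \<partial>Leb) =
        (\<integral>\<^sup>+z. F (z + v) * ennreal (1/2) \<partial>Leb) + (\<integral>\<^sup>+z. F (z + - v) * ennreal (1/2) \<partial>Leb)"
      by (rule nn_integral_add) measurable
    moreover have "(\<integral>\<^sup>+z. F (z + w) * ennreal (1/2) \<partial>Leb) = (\<integral>\<^sup>+z. F (z + w) \<partial>Leb) * ennreal (1/2)" for w
      by (rule nn_integral_multc) measurable
    ultimately show ?thesis
      by (subst nn_integral_add) (measurable, simp only:)
  qed
  also have "\<dots> = (\<integral>\<^sup>+z. F z * ?r z \<partial>Leb) + (?I * ennreal (1/2) + ?I * ennreal (1/2))"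
    by (simp only: nn_integral_Leb_add[OF F])
  also have "?I * ennreal (1/2) + ?I * ennreal (1/2) = ?I"
    by (simp only: flip: distrib_left ennreal_plus) simp
  also have "(\<integral>\<^sup>+z. F z * ?r z \<partial>Leb) + ?I = (\<integral>\<^sup>+z. F z * ?r z + F z \<partial>Leb)"
    by (rule nn_integral_add[symmetric]) measurable
  also have "\<dots> = (\<integral>\<^sup>+z. inv_displacement A z * F z \<partial>Leb)"
    using pos
  proof (intro nn_integral_cong_AE, eventually_elim)
    case (elim z)
    have "F z * ?r z + F z = F z * (?r z + ennreal 1)" by (simp add: distrib_left)
    also have "?r z + ennreal 1 = ennreal ((1 - ?d z) / ?d z + 1)"
      using elim displacement_le_1[of A z] by (intro ennreal_plus[symmetric]) auto
    also have "(1 - ?d z) / ?d z + 1 = 1 / ?d z" using elim by (simp add: field_simps)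
    finally show ?case by (simp add: inv_displacement_eq[OF elim(2)] mult.commute)
  qed
  finally have *: "(\<integral>\<^sup>+z. inv_displacement A z * (\<integral>\<^sup>+u. F (move A v z u) \<partial>Leb) \<partial>Leb) =
      (\<integral>\<^sup>+z. inv_displacement A z * F z \<partial>Leb)" .
  have "(\<lambda>z. \<integral>\<^sup>+u. F (move A v z u) \<partial>Leb) \<in> borel_measurable borel"
    unfolding nn_integral_move[OF A] by measurable
  then show ?thesis by (simp add: nn_integral_mu_bar A * cong del: nn_integral_cong)
qed

text \<open>At the points of the orbit the harmonicity says that the second differences vanish; a
  bounded sequence with this property is constant.\<close>

lemma harmonic_imp_invariant:
  fixes A :: "'k::finite torus set" and H :: "'k torus \<Rightarrow> real"
  assumes A: "A \<in> sets borel" and sym: "no_translational_symmetries A"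
    and H: "\<And>z. 0 \<le> H z" "\<And>z. H z \<le> 1"
    and harm: "\<And>z. ennreal (H z) = (\<integral>\<^sup>+u. ennreal (H (move A v z u)) \<partial>Leb)"
  shows "AE z in Leb. H (z + v) = H z"
proof -
  have avg: "2 * H z = H (z + v) + H (z - v)" if "z \<noteq> 0" for z
  proof -
    let ?d = "displacement A z"
    have d: "0 < ?d" "?d \<le> 1"
      using that sym displacement_nonneg[of A z] displacement_le_1[of A z]
      by (auto simp: no_translational_symmetries_def less_le)
    have "ennreal (H z) = ennreal (H z) * ennreal (1 - ?d) + ennreal (H (z + v)) * ennreal (?d / 2)
        + ennreal (H (z - v)) * ennreal (?d / 2)"
      using harm[of z] nn_integral_move[OF A, of "\<lambda>x. ennreal (H x)" v z] by (rule trans)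
    also have "\<dots> = ennreal (H z * (1 - ?d) + H (z + v) * (?d / 2) + H (z - v) * (?d / 2))"
      using d H by (simp flip: ennreal_mult ennreal_plus)
    finally have "ennreal (H z) = ennreal (H z * (1 - ?d) + H (z + v) * (?d / 2) + H (z - v) * (?d / 2))" .
    then have "H z = H z * (1 - ?d) + H (z + v) * (?d / 2) + H (z - v) * (?d / 2)"
      using d H by (subst (asm) ennreal_inj) (auto intro!: add_nonneg_nonneg mult_nonneg_nonneg)
    then have "?d * (2 * H z) = ?d * (H (z + v) + H (z - v))" by (simp add: algebra_simps)
    then show ?thesis using d by simp
  qed
  \<comment> \<open>The sum over \<open>i<n\<close> is the \<open>n\<close>-fold multiple of
    \<open>v\<close>. The averaging relation is available only off 0, so orbits through 0 are
    discarded.\<close>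
  have "AE z in Leb. z + (\<Sum>i<n. v) \<noteq> 0" for n :: nat
    by (rule AE_Leb_add[OF AE_Leb_neq])
  then have "AE z in Leb. \<forall>n::nat. z + (\<Sum>i<n. v) \<noteq> 0"
    by (simp add: AE_all_countable)
  then show ?thesis
  proof eventually_elim
    case (elim z)
    define a where "a n = H (z + (\<Sum>i<n. v))" for n :: nat
    have step: "a (Suc (Suc n)) - a (Suc n) = a (Suc n) - a n" for n
      using avg[OF elim[rule_format, of "Suc n"]] by (simp add: a_def add.assoc)
    have diff: "a (Suc n) - a n = a 1 - a 0" for n
    proof (induction n)
      case (Suc n)
      then show ?case using step[of n] by linarith
    qed simp
    have lin: "a n = a 0 + real n * (a 1 - a 0)" for n
    proof (induction n)
      case (Suc n)
      have "real (Suc n) * (a 1 - a 0) = real n * (a 1 - a 0) + (a 1 - a 0)"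
        by (simp add: distrib_right)
      then show ?case using Suc diff[of n] by linarith
    qed simp
    have "a 1 = a 0"
    proof (rule ccontr)
      assume "a 1 \<noteq> a 0"
      then obtain n where "2 < real n * \<bar>a 1 - a 0\<bar>"
        using reals_Archimedean3[of "\<bar>a 1 - a 0\<bar>"] by auto
      then have "2 < \<bar>a n - a 0\<bar>" by (simp add: lin[of n] abs_mult)
      moreover have "\<bar>a n - a 0\<bar> \<le> 1"
        using H[of "z + (\<Sum>i<n. v)"] H[of z] by (auto simp: a_def abs_le_iff)
      ultimately show False by simp
    qed
    then show ?case by (simp add: a_def)
  qed
qed

section \<open>The noise space and the skew product over the shift\<close>

interpretation noise: sequence_space "Leb :: 'k::finite torus measure" ..

lemma prob_space_noise_measure: "prob_space (noise_measure :: (nat \<Rightarrow> 'k::finite torus) measure)"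
  unfolding noise_measure_def by (intro prob_space_PiM prob_space_Leb)

lemma space_noise_measure [simp]: "space noise_measure = UNIV"
  by (simp add: noise_measure_def space_PiM)

lemma measurable_noise_component [measurable]: "(\<lambda>w. w n) \<in> borel_measurable noise_measure"
proof -
  have "(\<lambda>w. w n) \<in> measurable (\<Pi>\<^sub>M i\<in>UNIV. Leb) Leb" by measurable
  then show ?thesis by (simp add: noise_measure_def cong: measurable_cong_sets)
qed

lemma measurable_into_noise:
  assumes "\<And>n. (\<lambda>x. f x n) \<in> borel_measurable M"
  shows "f \<in> measurable M noise_measure"
  unfolding noise_measure_def
  by (rule measurable_PiM_single') (use assms in \<open>simp_all cong: measurable_cong_sets\<close>)

text \<open>Conditioning on the first entry: the remaining sequence is independent of it and has the
  same law.\<close>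

lemma nn_integral_noise_split:
  fixes F :: "(nat \<Rightarrow> 'k::finite torus) \<Rightarrow> ennreal"
  assumes [measurable]: "F \<in> borel_measurable noise_measure"
  shows "(\<integral>\<^sup>+w. F w \<partial>noise_measure) = (\<integral>\<^sup>+u. \<integral>\<^sup>+w. F (case_nat u w) \<partial>noise_measure \<partial>Leb)"
proof -
  interpret S: prob_space "noise_measure :: (nat \<Rightarrow> 'k torus) measure"
    by (rule prob_space_noise_measure)
  have m [measurable]: "(\<lambda>(u, w). case_nat u w) \<in> measurable (Leb \<Otimes>\<^sub>M noise_measure) (noise_measure :: (nat \<Rightarrow> 'k torus) measure)"
    unfolding noise_measure_def by measurable
  have "(\<integral>\<^sup>+w. F w \<partial>noise_measure) = (\<integral>\<^sup>+w. F w \<partial>distr (Leb \<Otimes>\<^sub>M noise_measure) noise_measure (\<lambda>(u, w). case_nat u w))"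
    using noise.PiM_iter[where 'k='k] by (simp add: noise_measure_def)
  also have "\<dots> = (\<integral>\<^sup>+p. F (case p of (u, w) \<Rightarrow> case_nat u w) \<partial>(Leb \<Otimes>\<^sub>M noise_measure))"
    by (rule nn_integral_distr) measurable
  also have "\<dots> = (\<integral>\<^sup>+u. \<integral>\<^sup>+w. F (case_nat u w) \<partial>noise_measure \<partial>Leb)"
    using S.nn_integral_fst[OF measurable_compose[OF m assms]] by simp
  finally show ?thesis .
qed

text \<open>The second component is meant to list the successive positions of the first point rather
  than the noise; one entry is consumed per step.\<close>

definition chain_step :: "'k::finite torus set \<Rightarrow> 'k torus \<Rightarrow> 'k torus \<times> (nat \<Rightarrow> 'k torus) \<Rightarrow> 'k torus \<times> (nat \<Rightarrow> 'k torus)" where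
  "chain_step A v p = (move A v (fst p) (snd p 0), \<lambda>n. snd p (Suc n))"

locale difference_chain =
  fixes A :: "'k::finite torus set" and v :: "'k torus"
  assumes k: "CARD('k) > 1" and A [measurable]: "A \<in> sets borel"
    and sym: "no_translational_symmetries A" and min: "minimal_map (translation v)"
begin

abbreviation "N \<equiv> mu_bar A \<Otimes>\<^sub>M (noise_measure :: (nat \<Rightarrow> 'k torus) measure)"

lemma fin: "norm_const A < \<infinity>"
  by (rule norm_const_finite[OF k A sym])

sublocale M: prob_space "mu_bar A"
  by (rule prob_space_mu_bar[OF A fin])

sublocale S: prob_space "noise_measure :: (nat \<Rightarrow> 'k torus) measure"
  by (rule prob_space_noise_measure)

sublocale P: pair_prob_space "mu_bar A" "noise_measure :: (nat \<Rightarrow> 'k torus) measure" ..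

lemma measurable_chain_step [measurable]: "chain_step A v \<in> measurable N N"
proof -
  have "(\<lambda>p. \<lambda>n. snd p (Suc n)) \<in> measurable N noise_measure"
    by (rule measurable_into_noise) measurable
  moreover have "(\<lambda>p. move A v (fst p) (snd p 0)) \<in> borel_measurable N"
    by measurable
  ultimately show ?thesis
    unfolding chain_step_def by (intro measurable_Pair) (simp_all cong: measurable_cong_sets)
qed

lemma nn_integral_chain_step:
  assumes [measurable]: "F \<in> borel_measurable N"
  shows "(\<integral>\<^sup>+\<xi>. F (chain_step A v (z, \<xi>)) \<partial>noise_measure) =
    (\<integral>\<^sup>+u. \<integral>\<^sup>+\<xi>. F (move A v z u, \<xi>) \<partial>noise_measure \<partial>Leb)"
proof -
  have "(\<lambda>\<xi>. (z, \<xi>)) \<in> measurable noise_measure N" by measurable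
  then have [measurable]: "(\<lambda>\<xi>. F (chain_step A v (z, \<xi>))) \<in> borel_measurable noise_measure"
    by measurable
  show ?thesis
    by (subst nn_integral_noise_split, fact) (simp add: chain_step_def)
qed

text \<open>Integrating out the tail of the sequence leaves the section measures of
  \<open>X\<close>, evaluated after one move, and \<open>mu_bar A\<close> is stationary for the
  move.\<close>

lemma distr_chain_step: "distr N N (chain_step A v) = N"
proof (rule measure_eqI)
  fix X assume "X \<in> sets (distr N N (chain_step A v))"
  then have X [measurable]: "X \<in> sets N" by simp
  let ?G = "\<lambda>z. \<integral>\<^sup>+\<xi>. indicator X (z, \<xi>) \<partial>noise_measure"
  have [measurable]: "?G \<in> borel_measurable borel"
    using S.borel_measurable_nn_integral_fst[of "indicator X" "mu_bar A"]
    by (simp cong: measurable_cong_sets)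
  have "emeasure (distr N N (chain_step A v)) X = (\<integral>\<^sup>+p. indicator X p \<partial>distr N N (chain_step A v))"
    using X by simp
  also have "\<dots> = (\<integral>\<^sup>+p. indicator X (chain_step A v p) \<partial>N)"
    by (rule nn_integral_distr) measurable
  also have "\<dots> = (\<integral>\<^sup>+z. \<integral>\<^sup>+\<xi>. indicator X (chain_step A v (z, \<xi>)) \<partial>noise_measure \<partial>mu_bar A)"
    by (rule S.nn_integral_fst[symmetric]) measurable
  also have "\<dots> = (\<integral>\<^sup>+z. \<integral>\<^sup>+u. ?G (move A v z u) \<partial>Leb \<partial>mu_bar A)"
    by (subst nn_integral_chain_step) simp_all
  also have "\<dots> = (\<integral>\<^sup>+z. ?G z \<partial>mu_bar A)"
    by (rule nn_integral_mu_bar_move[OF A sym]) measurable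
  also have "\<dots> = (\<integral>\<^sup>+p. indicator X p \<partial>N)"
    by (rule S.nn_integral_fst) measurable
  also have "\<dots> = emeasure N X" using X by simp
  finally show "emeasure (distr N N (chain_step A v)) X = emeasure N X" .
qed simp

text \<open>The section measures of the invariant event \<open>unbounded_sums\<close> form a bounded harmonic
  function, which is almost surely a constant \<open>c\<close>. The maximal inequality then becomes
  \<open>0 \<le> c * \<integral>f\<close>.\<close>

lemma AE_bounded_sums_if_integral_neg:
  fixes f :: "'k torus \<Rightarrow> real"
  assumes f [measurable]: "f \<in> borel_measurable borel" and C: "\<And>x. \<bar>f x\<bar> \<le> C"
    and neg: "(\<integral>x. f x \<partial>mu_bar A) < 0"
  shows "AE p in N. \<exists>K. \<forall>n. (\<Sum>j<n. f (fst ((chain_step A v ^^ j) p))) \<le> K"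
proof -
  let ?f = "\<lambda>p :: 'k torus \<times> (nat \<Rightarrow> 'k torus). f (fst p)"
  let ?E = "unbounded_sums N (chain_step A v) ?f"
  have f' [measurable]: "?f \<in> borel_measurable N" by measurable
  have E [measurable]: "?E \<in> sets N" by measurable
  have inv: "chain_step A v p \<in> ?E \<longleftrightarrow> p \<in> ?E" for p
    by (rule unbounded_sums_invariant[OF measurable_chain_step, of ?f C])
       (simp_all add: C space_pair_measure)
  define H where "H z = measure noise_measure {\<xi>. (z, \<xi>) \<in> ?E}" for z
  have secm: "{\<xi>. (z, \<xi>) \<in> ?E} \<in> sets noise_measure" for z
    using sets_Pair1[OF E, of z] by (simp add: vimage_def)
  have H_eq: "ennreal (H z) = (\<integral>\<^sup>+\<xi>. indicator ?E (z, \<xi>) \<partial>noise_measure)" for z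
  proof -
    have "(\<integral>\<^sup>+\<xi>. indicator ?E (z, \<xi>) \<partial>noise_measure) = (\<integral>\<^sup>+\<xi>. indicator {\<xi>. (z, \<xi>) \<in> ?E} \<xi> \<partial>noise_measure)"
      by (intro nn_integral_cong) (simp add: indicator_def)
    also have "\<dots> = emeasure noise_measure {\<xi>. (z, \<xi>) \<in> ?E}"
      using secm by simp
    finally show ?thesis by (simp add: H_def S.emeasure_eq_measure)
  qed
  have H_int: "H z = (\<integral>\<xi>. indicator ?E (z, \<xi>) \<partial>noise_measure)" for z
  proof -
    have "(\<integral>\<xi>. indicator ?E (z, \<xi>) \<partial>noise_measure) = (\<integral>\<xi>. indicator {\<xi>. (z, \<xi>) \<in> ?E} \<xi> \<partial>noise_measure)"
      by (intro Bochner_Integration.integral_cong) (simp_all add: indicator_def)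
    also have "\<dots> = H z" by (simp add: H_def)
    finally show ?thesis ..
  qed
  have [measurable]: "H \<in> borel_measurable borel"
  proof -
    have "(\<lambda>z. \<integral>\<^sup>+\<xi>. indicator ?E (z, \<xi>) \<partial>noise_measure) \<in> borel_measurable (mu_bar A)"
      using S.borel_measurable_nn_integral_fst[of "indicator ?E" "mu_bar A"] by simp
    then have "(\<lambda>z. enn2real (ennreal (H z))) \<in> borel_measurable (mu_bar A)"
      unfolding H_eq by measurable
    moreover have "(\<lambda>z. enn2real (ennreal (H z))) = H" by (rule ext) (simp add: H_def)
    ultimately show ?thesis by (simp cong: measurable_cong_sets)
  qed
  \<comment> \<open>Harmonicity is the invariance of the event, followed by conditioning on the
    first entry of the sequence.\<close>
  have harm: "ennreal (H z) = (\<integral>\<^sup>+u. ennreal (H (move A v z u)) \<partial>Leb)" for z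
  proof -
    have "ennreal (H z) = (\<integral>\<^sup>+\<xi>. indicator ?E (chain_step A v (z, \<xi>)) \<partial>noise_measure)"
      unfolding H_eq by (intro nn_integral_cong) (simp add: indicator_def inv)
    also have "\<dots> = (\<integral>\<^sup>+u. ennreal (H (move A v z u)) \<partial>Leb)"
      unfolding H_eq by (rule nn_integral_chain_step) measurable
    finally show ?thesis .
  qed
  have "AE z in Leb. H (z + v) = H z"
    by (rule harmonic_imp_invariant[OF A sym _ _ harm]) (simp_all add: H_def)
  then obtain c where c: "AE z in Leb. H z = c"
    using AE_const_if_invariant[OF min \<open>H \<in> borel_measurable borel\<close>] by blast
  then have cM: "AE z in mu_bar A. H z = c"
    by (simp add: AE_mu_bar_iff[OF A fin])
  obtain z where "H z = c"
    using eventually_happens'[OF Leb.ae_filter_bot c] by blast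
  then have c0: "0 \<le> c" by (auto simp: H_def)
  have C0: "0 \<le> C" using C[of undefined] by linarith
  have int: "integrable N (\<lambda>p. indicator ?E p * ?f p)"
    by (rule P.integrable_const_bound[of _ C]) (auto simp: indicator_def C C0)
  have "0 \<le> (\<integral>p. indicator ?E p * ?f p \<partial>N)"
    by (rule P.integral_unbounded_sums_nonneg[OF measurable_chain_step distr_chain_step f']) (rule C)
  also have "\<dots> = (\<integral>z. (\<integral>\<xi>. indicator ?E (z, \<xi>) * f z \<partial>noise_measure) \<partial>mu_bar A)"
    using P.integral_fst'[OF int] by simp
  \<comment> \<open>The factor \<open>f z\<close> does not depend on the sequence, so only the
    indicator is integrated over it.\<close>
  also have "\<dots> = (\<integral>z. H z * f z \<partial>mu_bar A)"
    by (simp add: H_int)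
  also have "\<dots> = (\<integral>z. c * f z \<partial>mu_bar A)"
  proof (rule integral_cong_AE)
    show "AE z in mu_bar A. H z * f z = c * f z" using cM by eventually_elim simp
    have "(\<lambda>z. H z * f z) \<in> borel_measurable borel" "(\<lambda>z. c * f z) \<in> borel_measurable borel"
      by simp_all
    then show "(\<lambda>z. H z * f z) \<in> borel_measurable (mu_bar A)" "(\<lambda>z. c * f z) \<in> borel_measurable (mu_bar A)"
      by (simp_all cong: measurable_cong_sets)
  qed
  also have "\<dots> = c * (\<integral>z. f z \<partial>mu_bar A)" by simp
  finally have "c = 0" using neg c0 by (auto simp: zero_le_mult_iff)
  have "emeasure N ?E = (\<integral>\<^sup>+p. indicator ?E p \<partial>N)" using E by simp
  also have "\<dots> = (\<integral>\<^sup>+z. ennreal (H z) \<partial>mu_bar A)"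
    unfolding H_eq by (rule S.nn_integral_fst[symmetric]) measurable
  also have "\<dots> = (\<integral>\<^sup>+z. 0 \<partial>mu_bar A)"
    by (rule nn_integral_cong_AE) (use cM \<open>c = 0\<close> in auto)
  finally have "emeasure N ?E = 0" by simp
  then have "AE p in N. p \<notin> ?E"
    by (rule AE_not_in[OF null_setsI[OF _ E]])
  then show ?thesis
  proof eventually_elim
    case (elim p)
    then obtain K :: nat where K: "\<And>n. birkhoff_max (chain_step A v) ?f n p \<le> real K"
      by (auto simp: unbounded_sums_def space_pair_measure not_less)
    have "(\<Sum>j<n. f (fst ((chain_step A v ^^ j) p))) \<le> real K" for n
    proof (cases n)
      case (Suc m)
      then show ?thesis
        using birkhoff_max_ge_sum[of ?f "chain_step A v" p m] K[of m] by simp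
    qed simp
    then show ?case by blast
  qed
qed

text \<open>Apply the previous lemma to \<open>g\<close> minus a number slightly above its mean, and
  to a number slightly below the mean minus \<open>g\<close>. Both have negative integral, so their
  sums are bounded above, which bounds the averages from either side; the margins 1/(l+1) are
  countably many.\<close>

lemma AE_averages_tendsto:
  fixes g :: "'k torus \<Rightarrow> real"
  assumes g [measurable]: "g \<in> borel_measurable borel" and C: "\<And>x. \<bar>g x\<bar> \<le> C"
  shows "AE p in N. (\<lambda>n. (\<Sum>j<n. g (fst ((chain_step A v ^^ j) p))) / real n) \<longlonglongrightarrow> (\<integral>x. g x \<partial>mu_bar A)"
proof -
  define m where "m = (\<integral>x. g x \<partial>mu_bar A)"
  have int: "integrable (mu_bar A) g"
    by (rule M.integrable_const_bound[of _ C]) (simp_all add: C cong: measurable_cong_sets)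
  let ?s = "\<lambda>p n. \<Sum>j<n. g (fst ((chain_step A v ^^ j) p))"
  have "AE p in N. \<forall>l. \<exists>K. \<forall>n. ?s p n - real n * (m + 1 / real (Suc l)) \<le> K"
    unfolding AE_all_countable
  proof
    fix l
    let ?f = "\<lambda>x. g x - (m + 1 / real (Suc l))"
    have "AE p in N. \<exists>K. \<forall>n. (\<Sum>j<n. ?f (fst ((chain_step A v ^^ j) p))) \<le> K"
    proof (rule AE_bounded_sums_if_integral_neg)
      show "\<bar>?f x\<bar> \<le> C + (\<bar>m\<bar> + 1 / real (Suc l))" for x
        using C[of x] abs_triangle_ineq4[of "g x" "m + 1 / real (Suc l)"]
          abs_triangle_ineq[of m "1 / real (Suc l)"] by simp
      show "(\<integral>x. ?f x \<partial>mu_bar A) < 0"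
        using int M.prob_space by (simp add: m_def[symmetric])
    qed measurable
    then show "AE p in N. \<exists>K. \<forall>n. ?s p n - real n * (m + 1 / real (Suc l)) \<le> K"
      by (simp add: sum_subtractf)
  qed
  moreover have "AE p in N. \<forall>l. \<exists>K. \<forall>n. real n * (m - 1 / real (Suc l)) - ?s p n \<le> K"
    unfolding AE_all_countable
  proof
    fix l
    let ?f = "\<lambda>x. (m - 1 / real (Suc l)) - g x"
    have "AE p in N. \<exists>K. \<forall>n. (\<Sum>j<n. ?f (fst ((chain_step A v ^^ j) p))) \<le> K"
    proof (rule AE_bounded_sums_if_integral_neg)
      show "\<bar>?f x\<bar> \<le> C + (\<bar>m\<bar> + 1 / real (Suc l))" for x
        using C[of x] abs_triangle_ineq4[of "m - 1 / real (Suc l)" "g x"]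
          abs_triangle_ineq4[of m "1 / real (Suc l)"] by simp
      show "(\<integral>x. ?f x \<partial>mu_bar A) < 0"
        using int M.prob_space by (simp add: m_def[symmetric])
    qed measurable
    then show "AE p in N. \<exists>K. \<forall>n. real n * (m - 1 / real (Suc l)) - ?s p n \<le> K"
      by (simp add: sum_subtractf)
  qed
  ultimately show ?thesis
  proof eventually_elim
    case (elim p)
    show ?case unfolding m_def[symmetric]
    proof (rule LIMSEQ_I)
      fix e :: real assume e: "0 < e"
      obtain l where l: "1 / real (Suc l) < e / 2"
        using nat_approx_posE[of "e / 2"] e by (auto simp: inverse_eq_divide)
      define d where "d = 1 / real (Suc l)"
      obtain K where K: "\<And>n. ?s p n - real n * (m + d) \<le> K"
        using elim(1) unfolding d_def by blast
      obtain K' where K': "\<And>n. real n * (m - d) - ?s p n \<le> K'"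
        using elim(2) unfolding d_def by blast
      \<comment> \<open>Half of \<open>e\<close> absorbs the constants \<open>K\<close> and
        \<open>K'\<close> after division by \<open>n\<close>, the other half absorbs the margin
        \<open>d\<close>.\<close>
      obtain n0 :: nat where n0: "max \<bar>K\<bar> \<bar>K'\<bar> < real n0 * (e / 2)"
        using reals_Archimedean3[of "e / 2"] e by auto
      show "\<exists>no. \<forall>n\<ge>no. norm (?s p n / real n - m) < e"
      proof (intro exI[of _ "Suc n0"] allI impI)
        fix n assume n: "Suc n0 \<le> n"
        then have n_pos: "0 < real n" by simp
        have "real n0 * (e / 2) \<le> real n * (e / 2)" using n e by (intro mult_right_mono) auto
        then have Kn: "K < real n * (e / 2)" "K' < real n * (e / 2)" using n0 by auto
        have "real n * d < real n * (e / 2)"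
          unfolding d_def by (rule mult_strict_left_mono[OF l n_pos])
        then have "?s p n - real n * m < real n * e" "real n * m - ?s p n < real n * e"
          using K[of n] K'[of n] Kn unfolding distrib_left right_diff_distrib by linarith+
        then have "\<bar>?s p n - real n * m\<bar> < real n * e" by (simp add: abs_less_iff)
        moreover have "?s p n / real n - m = (?s p n - real n * m) / real n"
          using n_pos by (simp add: field_simps)
        ultimately show "norm (?s p n / real n - m) < e"
          using n_pos by (simp add: abs_divide divide_less_eq mult.commute)
      qed
    qed
  qed
qed

end

subsection \<open>The noise along an orbit\<close>

lemma measurable_base_map [measurable]:
  assumes [measurable]: "A \<in> sets borel"
  shows "base_map A v \<in> borel_measurable borel"
  unfolding base_map_def by measurable

lemma random_iterate_Suc:
  "random_iterate A v w (Suc n) x = base_map A v (random_iterate A v w n x) + w n"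
  by (simp add: noisy_map_def translation_def)

lemma measurable_random_iterate [measurable]:
  assumes [measurable]: "A \<in> sets borel"
  shows "(\<lambda>w. random_iterate A v w n x) \<in> borel_measurable noise_measure"
proof (induction n)
  case (Suc n)
  note [measurable] = Suc measurable_base_map[of A v]
  show ?case unfolding random_iterate_Suc by measurable
qed simp

text \<open>The recursion splits off the last noise; induction over independent entries needs the
  first one split off, which restarts the system at a new point.\<close>

lemma random_iterate_case_nat:
  "random_iterate A v (case_nat u w) (Suc n) x = random_iterate A v w n (base_map A v x + u)"
proof (induction n)
  case (Suc n)
  have "random_iterate A v (case_nat u w) (Suc (Suc n)) x
      = base_map A v (random_iterate A v (case_nat u w) (Suc n) x) + w n"
    using random_iterate_Suc[of A v "case_nat u w" "Suc n" x] by (simp only: nat.case)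
  also have "\<dots> = base_map A v (random_iterate A v w n (base_map A v x + u)) + w n"
    by (simp only: Suc)
  also have "\<dots> = random_iterate A v w (Suc n) (base_map A v x + u)"
    by (rule random_iterate_Suc[symmetric])
  finally show ?case .
qed (simp add: noisy_map_def translation_def)

text \<open>After one step the position is a fixed point plus uniform noise, hence uniform. The rest
  has, by induction for all starting points, a probability that does not depend on where that step
  landed, so the product splits.\<close>

lemma emeasure_random_iterate:
  fixes A :: "'k::finite torus set"
  assumes A [measurable]: "A \<in> sets borel" and B: "\<And>j. B j \<in> sets borel"
  shows "emeasure noise_measure {w. \<forall>j<n. random_iterate A v w (Suc j) x \<in> B j} = (\<Prod>j<n. emeasure Leb (B j))"
  using B
proof (induction n arbitrary: x B)
  case 0
  interpret S: prob_space "noise_measure :: (nat \<Rightarrow> 'k torus) measure"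
    by (rule prob_space_noise_measure)
  show ?case using S.emeasure_space_1 by simp
next
  case (Suc n)
  note [measurable] = Suc.prems
  let ?W = "\<lambda>n B x. {w. \<forall>j<n. random_iterate A v w (Suc j) x \<in> B j}"
  have W: "?W n B x \<in> sets noise_measure" if [measurable]: "\<And>j. B j \<in> sets borel" for n B x
  proof -
    note [measurable] = measurable_random_iterate[OF A]
    have "Measurable.pred noise_measure (\<lambda>w. \<forall>j<n. random_iterate A v w (Suc j) x \<in> B j)"
      by (simp only: random_iterate_Suc) measurable
    then show ?thesis by (simp add: pred_def)
  qed
  have "emeasure noise_measure (?W (Suc n) B x) = (\<integral>\<^sup>+w. indicator (?W (Suc n) B x) w \<partial>noise_measure)"
    using W Suc.prems by simp
  also have "\<dots> = (\<integral>\<^sup>+u. \<integral>\<^sup>+w. indicator (?W (Suc n) B x) (case_nat u w) \<partial>noise_measure \<partial>Leb)"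
    by (rule nn_integral_noise_split) (intro borel_measurable_indicator W Suc.prems)
  also have "\<dots> = (\<integral>\<^sup>+u. indicator (B 0) (base_map A v x + u) * (\<Prod>j<n. emeasure Leb (B (Suc j))) \<partial>Leb)"
  proof (intro nn_integral_cong)
    fix u
    let ?y = "base_map A v x + u"
    have "case_nat u w \<in> ?W (Suc n) B x \<longleftrightarrow> ?y \<in> B 0 \<and> w \<in> ?W n (\<lambda>j. B (Suc j)) ?y" for w
      by (simp only: mem_Collect_eq random_iterate_case_nat All_less_Suc2 random_iterate.simps(1) id_apply)
    then have "(\<integral>\<^sup>+w. indicator (?W (Suc n) B x) (case_nat u w) \<partial>noise_measure)
        = (\<integral>\<^sup>+w. indicator (B 0) ?y * indicator (?W n (\<lambda>j. B (Suc j)) ?y) w \<partial>noise_measure)"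
      by (intro nn_integral_cong) (simp add: indicator_def)
    also have "\<dots> = indicator (B 0) ?y * emeasure noise_measure (?W n (\<lambda>j. B (Suc j)) ?y)"
      by (rule nn_integral_cmult_indicator) (intro W Suc.prems)
    also have "emeasure noise_measure (?W n (\<lambda>j. B (Suc j)) ?y) = (\<Prod>j<n. emeasure Leb (B (Suc j)))"
      by (intro Suc.IH Suc.prems)
    finally show "(\<integral>\<^sup>+w. indicator (?W (Suc n) B x) (case_nat u w) \<partial>noise_measure)
        = indicator (B 0) ?y * (\<Prod>j<n. emeasure Leb (B (Suc j)))" .
  qed
  also have "\<dots> = (\<integral>\<^sup>+u. indicator (B 0) (u + base_map A v x) \<partial>Leb) * (\<Prod>j<n. emeasure Leb (B (Suc j)))"
    by (subst add.commute) (rule nn_integral_multc, measurable)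
  also have "(\<integral>\<^sup>+u. indicator (B 0) (u + base_map A v x) \<partial>Leb) = emeasure Leb (B 0)"
    by (subst nn_integral_Leb_add) simp_all
  also have "emeasure Leb (B 0) * (\<Prod>j<n. emeasure Leb (B (Suc j))) = (\<Prod>j<Suc n. emeasure Leb (B j))"
    by (rule prod.lessThan_Suc_shift[symmetric])
  finally show ?case .
qed

text \<open>It suffices to compare cylinder sets. Time 0 is left out because the starting point is
  deterministic.\<close>

lemma distr_random_iterate:
  fixes A :: "'k::finite torus set"
  assumes A [measurable]: "A \<in> sets borel"
  shows "distr noise_measure noise_measure (\<lambda>w n. random_iterate A v w (Suc n) x) = noise_measure"
    (is "distr _ _ ?\<Theta> = _")
proof -
  have m: "?\<Theta> \<in> measurable noise_measure noise_measure"
    by (rule measurable_into_noise) (rule measurable_random_iterate[OF A])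
  have "distr noise_measure noise_measure ?\<Theta> = (\<Pi>\<^sub>M i\<in>UNIV. Leb)"
  proof (rule noise.PiM_eq)
    show "sets (distr noise_measure noise_measure ?\<Theta>) = sets (\<Pi>\<^sub>M i\<in>UNIV. Leb)"
      by (simp add: noise_measure_def)
  next
    fix J :: "nat set" and F :: "nat \<Rightarrow> 'k torus set"
    assume J: "finite J" "J \<subseteq> UNIV" and F: "\<And>j. j \<in> J \<Longrightarrow> F j \<in> sets Leb"
    obtain n where n: "J \<subseteq> {..<n}" using finite_nat_bounded[OF J(1)] by blast
    \<comment> \<open>Times outside \<open>J\<close> are padded with the whole space, which
      contributes a factor 1.\<close>
    define B where "B j = (if j \<in> J then F j else UNIV)" for j
    have B: "B j \<in> sets borel" for j using F by (simp add: B_def)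
    let ?X = "prod_emb UNIV (\<lambda>_. Leb) J (Pi\<^sub>E J F)"
    have X: "?X \<in> sets (\<Pi>\<^sub>M i\<in>UNIV. Leb)"
      using J F by (intro sets_PiM_I) auto
    have "emeasure (distr noise_measure noise_measure ?\<Theta>) ?X = emeasure noise_measure (?\<Theta> -` ?X)"
      using X by (subst emeasure_distr[OF m]) (simp_all add: noise_measure_def[symmetric])
    also have "?\<Theta> -` ?X = {w. \<forall>j<n. random_iterate A v w (Suc j) x \<in> B j}"
      using subsetD[OF n] by (auto simp: prod_emb_def B_def PiE_iff simp del: random_iterate.simps)
    also have "emeasure noise_measure \<dots> = (\<Prod>j<n. emeasure Leb (B j))"
      by (rule emeasure_random_iterate[OF A B])
    also have "\<dots> = (\<Prod>j\<in>J. emeasure Leb (B j))"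
    proof (rule prod.mono_neutral_right)
      show "\<forall>i\<in>{..<n} - J. emeasure Leb (B i) = 1"
        using Leb.emeasure_space_1[where 'k='k] by (simp add: B_def)
    qed (use n in auto)
    also have "\<dots> = (\<Prod>j\<in>J. emeasure Leb (F j))" by (simp add: B_def)
    finally show "emeasure (distr noise_measure noise_measure ?\<Theta>) ?X = (\<Prod>j\<in>J. emeasure Leb (F j))" .
  qed
  then show ?thesis by (simp add: noise_measure_def)
qed

text \<open>The chain starts after the deterministic first move, so its state at \<open>j\<close> is
  the difference at time \<open>Suc j\<close>. The second point enters through the first state
  only.\<close>

lemma chain_step_random_iterate:
  "(chain_step A v ^^ j) (move A v (x - y) x, \<lambda>n. random_iterate A v w (Suc n) x) =
    (random_iterate A v w (Suc j) x - random_iterate A v w (Suc j) y,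
     \<lambda>n. random_iterate A v w (Suc (n + j)) x)"
proof (induction j)
  case 0
  show ?case
    by (auto simp: move_def base_map_def noisy_map_def translation_def)
next
  case (Suc j)
  have "move A v (a - b) a = base_map A v a + u - (base_map A v b + u)" for a b u
    by (simp add: move_def base_map_def)
  then show ?case
    unfolding funpow.simps o_apply Suc
    unfolding chain_step_def fst_conv snd_conv
    by (simp only: random_iterate_Suc[of A v w "Suc j"] add_0_left add_Suc_right add_Suc)
qed

subsection \<open>Grid approximation\<close>

text \<open>The lower corner of the cell of side 1/(m+1) that contains \<open>x\<close>. Its fibres
  are countably many test sets over all \<open>m\<close>, finitely many for each.\<close>

definition grid_point :: "nat \<Rightarrow> 'k::finite torus \<Rightarrow> real ^ 'k" where
  "grid_point m x = (\<chi> i. of_int \<lfloor>real (Suc m) * frac_rep x $ i\<rfloor> / real (Suc m))"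

lemma measurable_grid_point [measurable]: "grid_point m \<in> borel_measurable borel"
proof (subst borel_measurable_euclidean_space, intro ballI)
  fix b :: "real ^ 'a" assume "b \<in> Basis"
  then obtain i where "b = axis i 1" by (auto simp: Basis_vec_def)
  moreover have "(\<lambda>x. grid_point m x $ i) \<in> borel_measurable borel"
    using measurable_frac_rep_nth[of i] unfolding grid_point_def vec_lambda_beta by measurable
  ultimately show "(\<lambda>x. grid_point m x \<bullet> b) \<in> borel_measurable borel"
    by (simp add: inner_axis)
qed

lemma sets_grid_cell: "{x :: 'k::finite torus. grid_point m x = t} \<in> sets borel"
  using measurable_sets[OF measurable_grid_point, of "{t}" m] by (simp add: vimage_def)

lemma frac_rep_nth: "0 \<le> frac_rep x $ i" "frac_rep x $ i < 1"
  using frac_rep_unit_cube[of x] by (auto simp: unit_cube_def)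

lemma finite_range_grid_point: "finite (range (grid_point m :: 'k::finite torus \<Rightarrow> _))"
proof (rule finite_subset)
  let ?S = "(\<lambda>j. real_of_int j / real (Suc m)) ` {0..int m}"
  show "range (grid_point m :: 'k torus \<Rightarrow> _) \<subseteq> vec_lambda ` (PiE UNIV (\<lambda>_. ?S))"
  proof
    fix y assume "y \<in> range (grid_point m :: 'k torus \<Rightarrow> _)"
    then obtain x :: "'k torus" where y: "y = grid_point m x" by auto
    have "y $ i \<in> ?S" for i
    proof -
      have "real (Suc m) * frac_rep x $ i < real (Suc m) * 1"
        using frac_rep_nth(2)[of x i] by (intro mult_strict_left_mono) auto
      then have "\<lfloor>real (Suc m) * frac_rep x $ i\<rfloor> < int (Suc m)" by (simp add: floor_less_iff)
      moreover have "0 \<le> \<lfloor>real (Suc m) * frac_rep x $ i\<rfloor>"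
        using frac_rep_nth(1)[of x i] by simp
      ultimately show ?thesis by (auto simp: y grid_point_def)
    qed
    then show "y \<in> vec_lambda ` (PiE UNIV (\<lambda>_. ?S))"
      by (intro image_eqI[of _ _ "vec_nth y"]) (simp_all add: PiE_iff)
  qed
  show "finite (vec_lambda ` (PiE (UNIV :: 'k set) (\<lambda>_. ?S)))"
    by (intro finite_imageI finite_PiE) auto
qed

lemma grid_point_close:
  fixes x :: "'k::finite torus"
  shows "dist (grid_point m x) (frac_rep x) \<le> real CARD('k) / real (Suc m)"
    and "grid_point m x \<in> cbox 0 1" "frac_rep x \<in> cbox 0 1"
proof -
  have *: "grid_point m x $ i \<le> frac_rep x $ i" "frac_rep x $ i \<le> grid_point m x $ i + 1 / real (Suc m)"
    "0 \<le> grid_point m x $ i" for i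
  proof -
    let ?t = "real (Suc m) * frac_rep x $ i"
    have "0 \<le> ?t" using frac_rep_nth(1)[of x i] by (intro mult_nonneg_nonneg) auto
    then have "0 \<le> real_of_int \<lfloor>?t\<rfloor>" by (simp only: of_int_0_le_iff zero_le_floor)
    moreover have "of_int \<lfloor>?t\<rfloor> \<le> ?t" "?t \<le> of_int \<lfloor>?t\<rfloor> + 1" by linarith+
    ultimately show "grid_point m x $ i \<le> frac_rep x $ i" "frac_rep x $ i \<le> grid_point m x $ i + 1 / real (Suc m)"
      "0 \<le> grid_point m x $ i"
      by (simp_all add: grid_point_def field_simps)
  qed
  have "norm (grid_point m x - frac_rep x) \<le> (\<Sum>i\<in>UNIV. \<bar>(grid_point m x - frac_rep x) $ i\<bar>)"
    by (rule norm_le_l1_cart)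
  also have "\<dots> \<le> (\<Sum>i\<in>(UNIV :: 'k set). 1 / real (Suc m))"
  proof (rule sum_mono)
    fix i show "\<bar>(grid_point m x - frac_rep x) $ i\<bar> \<le> 1 / real (Suc m)"
      using *(1,2)[of i] by (simp add: abs_le_iff)
  qed
  finally show "dist (grid_point m x) (frac_rep x) \<le> real CARD('k) / real (Suc m)"
    by (simp add: dist_norm)
  show "frac_rep x \<in> cbox 0 1"
    using frac_rep_nth[of x] by (simp add: mem_box_cart less_imp_le)
  show "grid_point m x \<in> cbox 0 1"
    using *(1,3) frac_rep_nth(2)[of x] by (simp add: mem_box_cart) (meson less_imp_le order_trans)
qed

text \<open>Lifted to the compact cube \<open>cbox 0 1\<close>, \<open>g\<close> is uniformly
  continuous, and this closed cube contains both the section and the grid points.\<close>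

lemma uniform_grid_approximation:
  fixes g :: "'k::finite torus \<Rightarrow> real"
  assumes g: "continuous_on UNIV g" and e: "0 < e"
  obtains m where "\<And>x. \<bar>g (to_torus (grid_point m x)) - g x\<bar> < e"
proof -
  have "continuous_on (cbox 0 1) (\<lambda>y. g (to_torus y))"
    by (rule continuous_on_subset[OF continuous_on_compose2[OF g continuous_on_to_torus]]) auto
  then have "uniformly_continuous_on (cbox 0 1) (\<lambda>y. g (to_torus y))"
    by (rule compact_uniformly_continuous) (rule compact_cbox)
  then obtain d where d: "0 < d" and
    unif: "\<And>y y'. y \<in> cbox 0 1 \<Longrightarrow> y' \<in> cbox 0 1 \<Longrightarrow> dist y' y < d \<Longrightarrow> dist (g (to_torus y')) (g (to_torus y)) < e"
    unfolding uniformly_continuous_on_def using e by metis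
  obtain n :: nat where n: "real CARD('k) < real n * d"
    using reals_Archimedean3[OF d] by blast
  have "real n * d \<le> real (Suc n) * d" using d by simp
  with n have "real CARD('k) < d * real (Suc n)" by (simp only: mult.commute[of d])
  then have nd: "real CARD('k) / real (Suc n) < d"
    by (subst pos_divide_less_eq) simp_all
  show ?thesis
  proof (rule that[of n])
    fix x :: "'k torus"
    have "dist (grid_point n x) (frac_rep x) < d"
      using grid_point_close(1)[of n x] nd by linarith
    then have "dist (g (to_torus (grid_point n x))) (g (to_torus (frac_rep x))) < e"
      by (intro unif grid_point_close)
    then show "\<bar>g (to_torus (grid_point n x)) - g x\<bar> < e" by (simp add: dist_real_def)
  qed
qed

text \<open>Up to e/3, uniformly, \<open>g\<close> is a finite combination of cell indicators; this
  error enters once in the averages and once in the integral.\<close>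

lemma tendsto_average_of_grid:
  fixes z :: "nat \<Rightarrow> 'k::finite torus" and M :: "'k torus measure"
  assumes M: "prob_space M" and sets_M [measurable_cong]: "sets M = sets borel"
    and lim: "\<And>m t. t \<in> range (grid_point m :: 'k torus \<Rightarrow> _) \<Longrightarrow>
      (\<lambda>n. (\<Sum>j<n. indicator {x. grid_point m x = t} (z j)) / real n) \<longlonglongrightarrow> measure M {x. grid_point m x = t}"
    and g: "continuous_on UNIV g" "bounded (range g)"
  shows "(\<lambda>n. (\<Sum>j<n. g (z j)) / real n) \<longlonglongrightarrow> (\<integral>x. g x \<partial>M)"
proof (rule LIMSEQ_I)
  fix e :: real assume e: "0 < e"
  interpret prob_space M by (rule M)
  have [measurable]: "g \<in> borel_measurable borel"
    by (rule borel_measurable_continuous_onI[OF g(1)])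
  obtain C where C: "\<And>x. \<bar>g x\<bar> \<le> C"
    using g(2) by (auto simp: bounded_iff)
  obtain m where m: "\<And>x. \<bar>g (to_torus (grid_point m x)) - g x\<bar> < e / 3"
    using uniform_grid_approximation[OF g(1), of "e / 3"] e by auto
  let ?R = "range (grid_point m :: 'k torus \<Rightarrow> _)"
  let ?h = "\<lambda>x. g (to_torus (grid_point m x))"
  have h: "?h x = (\<Sum>t\<in>?R. g (to_torus t) * indicator {x. grid_point m x = t} x)" for x
  proof -
    have "(\<Sum>t\<in>?R. g (to_torus t) * indicator {x. grid_point m x = t} x) =
        (\<Sum>t\<in>?R. if t = grid_point m x then g (to_torus t) else 0)"
      by (intro sum.cong) (auto simp: indicator_def)
    also have "\<dots> = ?h x" by (subst sum.delta[OF finite_range_grid_point]) simp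
    finally show ?thesis ..
  qed
  have int_ind: "integrable M (\<lambda>x. g (to_torus t) * indicator {x. grid_point m x = t} x)" for t
    by (intro integrable_mult_right integrable_real_indicator) (auto simp: sets_M less_top[symmetric])
  have int_h: "(\<integral>x. ?h x \<partial>M) = (\<Sum>t\<in>?R. g (to_torus t) * measure M {x. grid_point m x = t})"
  proof -
    have "(\<integral>x. ?h x \<partial>M) = (\<Sum>t\<in>?R. \<integral>x. g (to_torus t) * indicator {x. grid_point m x = t} x \<partial>M)"
      unfolding h by (rule Bochner_Integration.integral_sum) (rule int_ind)
    then show ?thesis using sets_eq_imp_space_eq[OF sets_M] by simp
  qed
  have sum_h: "(\<Sum>j<n. ?h (z j)) / real n =
      (\<Sum>t\<in>?R. g (to_torus t) * ((\<Sum>j<n. indicator {x. grid_point m x = t} (z j)) / real n))" for n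
    unfolding h by (subst sum.swap) (simp only: sum_distrib_left sum_divide_distrib times_divide_eq_right)
  have lim_h: "(\<lambda>n. (\<Sum>j<n. ?h (z j)) / real n) \<longlonglongrightarrow> (\<integral>x. ?h x \<partial>M)"
    unfolding sum_h int_h by (intro tendsto_sum tendsto_mult tendsto_const lim)
  then obtain n0 where n0: "\<And>n. n0 \<le> n \<Longrightarrow> \<bar>(\<Sum>j<n. ?h (z j)) / real n - (\<integral>x. ?h x \<partial>M)\<bar> < e / 3"
    using LIMSEQ_D[OF lim_h, of "e / 3"] e unfolding real_norm_def by auto
  have int_g: "integrable M g"
    by (rule integrable_const_bound[of _ C]) (simp_all add: C measurable_cong_sets[OF sets_M refl])
  have int_h': "integrable M ?h"
    unfolding h by (intro Bochner_Integration.integrable_sum int_ind)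
  have h_g: "\<bar>(\<integral>x. ?h x \<partial>M) - (\<integral>x. g x \<partial>M)\<bar> \<le> e / 3"
  proof -
    have "\<bar>(\<integral>x. ?h x - g x \<partial>M)\<bar> \<le> (\<integral>x. \<bar>?h x - g x\<bar> \<partial>M)"
      by (rule integral_abs_bound)
    also have "\<dots> \<le> (\<integral>x. e / 3 \<partial>M)"
      by (intro integral_mono) (use int_h' int_g m in \<open>auto intro: less_imp_le\<close>)
    finally show ?thesis using int_h' int_g prob_space by simp
  qed
  have g_h: "\<bar>(\<Sum>j<n. g (z j)) / real n - (\<Sum>j<n. ?h (z j)) / real n\<bar> \<le> e / 3" for n
  proof (cases "n = 0")
    case False
    have "\<bar>(\<Sum>j<n. g (z j)) - (\<Sum>j<n. ?h (z j))\<bar> \<le> (\<Sum>j<n. \<bar>?h (z j) - g (z j)\<bar>)"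
      unfolding sum_subtractf[symmetric] by (subst abs_minus_commute) (rule order_trans[OF sum_abs], simp add: abs_minus_commute)
    also have "\<dots> \<le> (\<Sum>j<n. e / 3)"
      by (intro sum_mono less_imp_le m)
    finally show ?thesis using False
      by (simp add: divide_le_eq mult.commute flip: diff_divide_distrib)
  qed (use e in simp)
  have "norm ((\<Sum>j<n. g (z j)) / real n - (\<integral>x. g x \<partial>M)) < e" if "n0 \<le> n" for n
    using n0[OF that] h_g g_h[of n] unfolding real_norm_def by linarith
  then show "\<exists>no. \<forall>n\<ge>no. norm ((\<Sum>j<n. g (z j)) / real n - (\<integral>x. g x \<partial>M)) < e" by blast
qed

section \<open>Empirical measures and the convergence theorem\<close>

lemma integral_empirical_measure:
  fixes g :: "'a::topological_space \<Rightarrow> real"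
  assumes g [measurable]: "g \<in> borel_measurable borel" and N: "N > 0"
  shows "integral\<^sup>L (empirical_measure p N) g = (\<Sum>n=1..N. g (p n)) / real N"
proof -
  \<comment> \<open>The empirical measure is the image under \<open>p\<close> of the uniform
    distribution on the times 1 to \<open>N\<close>, whose integral is a finite average.\<close>
  let ?U = "measure_pmf (pmf_of_set {1..N})"
  have "empirical_measure p N = distr ?U borel p"
  proof (rule measure_eqI)
    fix B assume "B \<in> sets (empirical_measure p N)"
    then have B [measurable]: "B \<in> sets borel" by simp
    have "emeasure (distr ?U borel p) B = emeasure ?U (p -` B)"
      by (subst emeasure_distr) auto
    also have "\<dots> = ennreal (real (card ({1..N} \<inter> p -` B)) / real N)"
      using N by (subst emeasure_pmf_of_set) auto
    also have "\<dots> = ennreal (1 / real N) * (\<Sum>n=1..N. indicator B (p n))"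
    proof -
      have "(\<Sum>n=1..N. indicator B (p n) :: ennreal) = (\<Sum>n=1..N. indicator (p -` B) n)"
        by (intro sum.cong) (auto simp: indicator_def)
      also have "\<dots> = of_nat (card ({1..N} \<inter> p -` B))"
        by (simp add: indicator_def Int_def vimage_def)
      finally show ?thesis
        by (simp add: ennreal_of_nat_eq_real_of_nat flip: ennreal_mult)
    qed
    finally show "emeasure (empirical_measure p N) B = emeasure (distr ?U borel p) B"
      by (simp add: emeasure_empirical_measure[OF B])
  qed simp
  then have "integral\<^sup>L (empirical_measure p N) g = (\<integral>n. g (p n) \<partial>?U)"
    by (simp add: integral_distr)
  also have "\<dots> = (\<Sum>n=1..N. g (p n)) / real N"
    using N by (subst integral_pmf_of_set) auto
  finally show ?thesis .
qed

lemma weakly_converges_empirical_measureI: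
  assumes "\<And>g :: 'a::topological_space \<Rightarrow> real. continuous_on UNIV g \<Longrightarrow> bounded (range g) \<Longrightarrow>
    (\<lambda>n. (\<Sum>j<n. g (p (Suc j))) / real n) \<longlonglongrightarrow> integral\<^sup>L L g"
  shows "weakly_converges (empirical_measure p) L"
  unfolding weakly_converges_def
proof (intro allI impI)
  fix g :: "'a \<Rightarrow> real" assume g: "continuous_on UNIV g" "bounded (range g)"
  have "\<forall>\<^sub>F n in sequentially. (\<Sum>j<n. g (p (Suc j))) / real n = integral\<^sup>L (empirical_measure p n) g"
    using eventually_gt_at_top[of 0]
  proof eventually_elim
    case (elim n)
    have "(\<Sum>j<n. g (p (Suc j))) = (\<Sum>j=1..n. g (p j))"
      by (rule sum.reindex_bij_witness[of _ "\<lambda>j. j - 1" Suc]) auto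
    then show ?case
      using integral_empirical_measure[OF borel_measurable_continuous_onI[OF g(1)] elim, of p] by simp
  qed
  then show "(\<lambda>n. integral\<^sup>L (empirical_measure p n) g) \<longlonglongrightarrow> integral\<^sup>L L g"
    using assms[OF g] by (rule Lim_transform_eventually[rotated])
qed

lemma (in difference_chain) AE_weakly_converges:
  "AE (x, y) in Leb \<Otimes>\<^sub>M Leb. AE w in noise_measure.
    weakly_converges
      (empirical_measure (\<lambda>n. random_iterate A v w n x - random_iterate A v w n y)) (mu_bar A)"
proof -
  \<comment> \<open>One condition for all countably many grid cells, so that a single null set
    serves every continuous test function.\<close>
  define good where "good p \<longleftrightarrow> (\<forall>m. \<forall>t\<in>range (grid_point m :: 'k torus \<Rightarrow> _).
    (\<lambda>n. (\<Sum>j<n. indicator {x. grid_point m x = t} (fst ((chain_step A v ^^ j) p))) / real n)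
      \<longlonglongrightarrow> measure (mu_bar A) {x. grid_point m x = t})" for p
  have "AE p in N. (\<lambda>n. (\<Sum>j<n. indicator {x. grid_point m x = t} (fst ((chain_step A v ^^ j) p))) / real n)
      \<longlonglongrightarrow> measure (mu_bar A) {x. grid_point m x = t}" for m t
  proof -
    have "(\<integral>x. indicator {x. grid_point m x = t} x \<partial>mu_bar A) = measure (mu_bar A) {x. grid_point m x = t}"
      by simp
    moreover have "AE p in N. (\<lambda>n. (\<Sum>j<n. indicator {x. grid_point m x = t} (fst ((chain_step A v ^^ j) p))) / real n)
        \<longlonglongrightarrow> (\<integral>x. indicator {x. grid_point m x = t} x \<partial>mu_bar A)"
      by (rule AE_averages_tendsto[where C=1])
         (rule borel_measurable_indicator[OF sets_grid_cell], simp add: indicator_def)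
    ultimately show ?thesis by (simp only:)
  qed
  then have "AE p in N. good p"
    unfolding good_def AE_all_countable
    by (intro allI AE_ball_countable') (auto intro: countable_finite finite_range_grid_point)
  then have "AE z in mu_bar A. AE \<xi> in noise_measure. good (z, \<xi>)"
    by (rule P.AE_pair)
  then have "AE z in Leb. AE \<xi> in noise_measure. good (z, \<xi>)"
    by (simp add: AE_mu_bar_iff[OF A fin])
  \<comment> \<open>A Borel null set containing the exceptional states, so that Fubini can be
    applied to the event of avoiding it.\<close>
  then obtain Z where Z: "{z. \<not> (AE \<xi> in noise_measure. good (z, \<xi>))} \<subseteq> Z" "Z \<in> null_sets Leb"
    by (auto simp: eventually_ae_filter)
  then have [measurable]: "Z \<in> sets borel" by (auto simp: null_sets_def)
  have nZ: "AE z in Leb. z \<notin> Z" using Z(2) by (rule AE_not_in)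
  interpret LL: pair_prob_space "Leb :: 'k torus measure" "Leb :: 'k torus measure" ..
  \<comment> \<open>With \<open>y\<close> fixed, the state after the first move is one of the
    translates of \<open>x\<close> by \<open>- y\<close>, \<open>v - y\<close> and
    \<open>- v - y\<close>; translations of \<open>x\<close> preserve null sets.\<close>
  have "AE y in Leb. AE x in Leb. move A v (x - y) x \<notin> Z"
  proof (rule AE_I2)
    fix y
    have "AE x in Leb. x + (c - y) \<notin> Z" for c
      by (rule AE_Leb_add[OF nZ])
    then have "AE x in Leb. x + (0 - y) \<notin> Z \<and> x + (v - y) \<notin> Z \<and> x + (- v - y) \<notin> Z"
      by (intro AE_conjI)
    then show "AE x in Leb. move A v (x - y) x \<notin> Z"
      by eventually_elim (auto simp: move_def algebra_simps)
  qed
  then have "AE x in Leb. AE y in Leb. move A v (x - y) x \<notin> Z"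
    by (subst LL.AE_commute) measurable
  moreover have S: "{q \<in> space (Leb \<Otimes>\<^sub>M Leb). move A v (fst q - snd q) (fst q) \<notin> Z} \<in> sets (Leb \<Otimes>\<^sub>M Leb)"
    by measurable
  ultimately have "AE q in Leb \<Otimes>\<^sub>M Leb. move A v (fst q - snd q) (fst q) \<notin> Z"
    by (intro LL.AE_pair_measure[OF S]) simp
  then show ?thesis
  proof eventually_elim
    case (elim q)
    obtain x y where q: "q = (x, y)" by (cases q)
    let ?z = "move A v (x - y) x"
    have m: "(\<lambda>w n. random_iterate A v w (Suc n) x) \<in> measurable noise_measure noise_measure"
      by (rule measurable_into_noise) (rule measurable_random_iterate[OF A])
    have "AE \<xi> in noise_measure. good (?z, \<xi>)" using elim Z(1) q by auto
    \<comment> \<open>The positions of the first point have the law of the noise, so a property of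
      almost every driving sequence holds for them.\<close>
    then have "AE \<xi> in distr noise_measure noise_measure (\<lambda>w n. random_iterate A v w (Suc n) x). good (?z, \<xi>)"
      by (subst distr_random_iterate[OF A])
    then have "AE w in noise_measure. good (?z, \<lambda>n. random_iterate A v w (Suc n) x)"
      by (rule AE_distrD[OF m])
    then have "AE w in noise_measure. weakly_converges
        (empirical_measure (\<lambda>n. random_iterate A v w n x - random_iterate A v w n y)) (mu_bar A)"
    proof eventually_elim
      case (elim w)
      show ?case
      proof (rule weakly_converges_empirical_measureI, rule tendsto_average_of_grid[OF M.prob_space_axioms sets_mu_bar])
        fix m and t :: "real ^ 'k"
        assume "t \<in> range (grid_point m :: 'k torus \<Rightarrow> _)"
        then show "(\<lambda>n. (\<Sum>j<n. indicator {x. grid_point m x = t} (random_iterate A v w (Suc j) x - random_iterate A v w (Suc j) y)) / real n)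
            \<longlonglongrightarrow> measure (mu_bar A) {x. grid_point m x = t}"
          using elim unfolding good_def chain_step_random_iterate fst_conv by blast
      qed
    qed
    then show ?case by (simp add: q)
  qed
qed

theorem theorem5:
  fixes A :: "'k::finite torus set" and v :: "'k torus"
  assumes "CARD('k) > 1"
    and "A \<in> sets borel"
    and "no_translational_symmetries A"
    and "minimal_map (translation v)"
  shows "norm_const A < \<infinity> \<and> prob_space (mu_bar A) \<and>
    (AE (x, y) in Leb \<Otimes>\<^sub>M Leb. AE w in noise_measure.
      weakly_converges
        (empirical_measure (\<lambda>n. random_iterate A v w n x - random_iterate A v w n y))
        (mu_bar A))"
proof -
  interpret difference_chain A v
    by standard (use assms in auto)
  show ?thesis
    using fin M.prob_space_axioms AE_weakly_converges by blast
qed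

end
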